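(* There is an absolute constant $C$ such that, for positive integers $n,k,r$ and a non-negative integer $s$, if $n\ge Ck^2r^3$ and $s\le \binom{n}{k}-\binom{n-r}{k}$, then any family $\mathcal{F}\subseteq\binom{[n]}{k}$ with $|\mathcal{F}|=s$ satisfies $\mathrm{dp}(\mathcal{F})\ge \mathrm{dp}(n,k,s)$; that is, $\mathcal{L}(n,k,s)$ minimises the number of disjoint pairs among families of $s$ sets in $\binom{[n]}{k}$.
   Context: $\binom{[n]}{k}$ is the family of all $k$-element subsets of $[n]=\{1,\dots,n\}$. For a set family $\mathcal{F}$, $\mathrm{dp}(\mathcal{F})$ is the number of (unordered) pairs of disjoint sets in $\mathcal{F}$. The lexicographic order on $\binom{[n]}{k}$ is given by $A<B$ if $\min(A\triangle B)\in A$. $\mathcal{L}(n,k,s)$ is the initial segment consisting of the first $s$ sets of $\binom{[n]}{k}$ in the lexicographic order, and $\mathrm{dp}(n,k,s)=\mathrm{dp}(\mathcal{L}(n,k,s))$. *)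

theory Defs
  imports Complex_Main "HOL-Library.Ramsey"
begin

definition dp :: "nat set set \<Rightarrow> nat" where
  "dp \<F> = card {{A, B} | A B. A \<in> \<F> \<and> B \<in> \<F> \<and> A \<noteq> B \<and> A \<inter> B = {}}"

(* The guard is needed because Min {} is unspecified. *)
definition lex_less :: "nat set \<Rightarrow> nat set \<Rightarrow> bool" where
  "lex_less A B \<longleftrightarrow> A \<noteq> B \<and> Min (sym_diff A B) \<in> A"

(* A set is among the first s when fewer than s of the k-sets precede it.
   For s > (n choose k) this is the whole of nsets {1..n} k. *)
definition lex_initial :: "nat \<Rightarrow> nat \<Rightarrow> nat \<Rightarrow> nat set set" where
  "lex_initial n k s =
     {A \<in> nsets {1..n} k. card {B \<in> nsets {1..n} k. lex_less B A} < s}"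

definition dp_lex :: "nat \<Rightarrow> nat \<Rightarrow> nat \<Rightarrow> nat" where
  "dp_lex n k s = dp (lex_initial n k s)"

lemma lex_less_iff:
  assumes "finite A" "finite B"
  shows "lex_less A B \<longleftrightarrow> (\<exists>m. m \<in> A \<and> m \<notin> B \<and> (\<forall>i<m. i \<in> A \<longleftrightarrow> i \<in> B))"
proof
  assume l: "lex_less A B"
  let ?D = "sym_diff A B"
  have ne: "?D \<noteq> {}" and mA: "Min ?D \<in> A" using l unfolding lex_less_def by auto
  have fin: "finite ?D" using assms by simp
  have "Min ?D \<in> ?D" using Min_in[OF fin ne] .
  moreover have "\<forall>i<Min ?D. i \<notin> ?D" using Min_le[OF fin] by (meson not_le)
  ultimately show "\<exists>m. m \<in> A \<and> m \<notin> B \<and> (\<forall>i<m. i \<in> A \<longleftrightarrow> i \<in> B)" using mA by blast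
next
  assume "\<exists>m. m \<in> A \<and> m \<notin> B \<and> (\<forall>i<m. i \<in> A \<longleftrightarrow> i \<in> B)"
  then obtain m where m: "m \<in> A" "m \<notin> B" "\<forall>i<m. i \<in> A \<longleftrightarrow> i \<in> B" by blast
  have "Min (sym_diff A B) = m"
    using assms m by (intro Min_eqI) (auto simp: not_less[symmetric])
  then show "lex_less A B" using m unfolding lex_less_def by auto
qed

lemma lex_less_irrefl: "\<not> lex_less A A"
  by (simp add: lex_less_def)

lemma lex_less_linear:
  assumes "finite A" "finite B" "A \<noteq> B"
  shows "lex_less A B \<or> lex_less B A"
proof -
  have "Min (sym_diff A B) \<in> (A - B) \<union> (B - A)"
    using assms by (intro Min_in) auto
  then show ?thesis using assms(3) unfolding lex_less_def by (auto simp: Un_commute)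
qed

lemma lex_less_trans:
  assumes "finite A" "finite B" "finite C" "lex_less A B" "lex_less B C"
  shows "lex_less A C"
proof -
  obtain m where m: "m \<in> A" "m \<notin> B" "\<forall>i<m. i \<in> A \<longleftrightarrow> i \<in> B"
    using lex_less_iff[OF assms(1,2)] assms(4) by auto
  obtain l where l: "l \<in> B" "l \<notin> C" "\<forall>i<l. i \<in> B \<longleftrightarrow> i \<in> C"
    using lex_less_iff[OF assms(2,3)] assms(5) by auto
  have "m \<noteq> l" using m l by auto
  then have "min m l \<in> A \<and> min m l \<notin> C \<and> (\<forall>i<min m l. i \<in> A \<longleftrightarrow> i \<in> C)"
    using m l by (cases "m < l") (auto simp: min_def)
  then show ?thesis using lex_less_iff[OF assms(1,3)] by blast
qed

lemma card_initial_segment: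
  assumes "finite X" "s \<le> card X"
    and irr: "\<And>x. x \<in> X \<Longrightarrow> \<not> R x x"
    and tr: "\<And>x y z. x \<in> X \<Longrightarrow> y \<in> X \<Longrightarrow> z \<in> X \<Longrightarrow> R x y \<Longrightarrow> R y z \<Longrightarrow> R x z"
    and lin: "\<And>x y. x \<in> X \<Longrightarrow> y \<in> X \<Longrightarrow> x \<noteq> y \<Longrightarrow> R x y \<or> R y x"
  shows "card {x \<in> X. card {y \<in> X. R y x} < s} = s"
proof -
  let ?f = "\<lambda>x. card {y \<in> X. R y x}"
  have mono: "?f x < ?f z" if "x \<in> X" "z \<in> X" "R x z" for x z
  proof (rule psubset_card_mono)
    show "finite {y \<in> X. R y z}" using assms(1) by simp
    show "{y \<in> X. R y x} \<subset> {y \<in> X. R y z}" using that irr tr by blast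
  qed
  have inj: "inj_on ?f X"
  proof (rule inj_onI, rule ccontr)
    fix x y assume xy: "x \<in> X" "y \<in> X" "?f x = ?f y" "x \<noteq> y"
    then show False using lin[OF xy(1,2,4)] mono[OF xy(1,2)] mono[OF xy(2,1)] by auto
  qed
  have "?f x < card X" if "x \<in> X" for x
    using irr[OF that] that assms(1) by (intro psubset_card_mono) auto
  then have "?f ` X \<subseteq> {..<card X}" by auto
  then have img: "?f ` X = {..<card X}"
    using card_image[OF inj] by (intro card_subset_eq) auto
  have "?f ` {x \<in> X. ?f x < s} = {..<s}"
  proof
    show "{..<s} \<subseteq> ?f ` {x \<in> X. ?f x < s}"
    proof
      fix i assume i: "i \<in> {..<s}"
      then have "i \<in> ?f ` X" using img assms(2) by auto
      then show "i \<in> ?f ` {x \<in> X. ?f x < s}" using i by auto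
    qed
  qed auto
  moreover have "inj_on ?f {x \<in> X. ?f x < s}"
    using inj by (rule inj_on_subset) auto
  ultimately show ?thesis using card_image by fastforce
qed

lemma lex_initial_subset: "lex_initial n k s \<subseteq> nsets {1..n} k"
  by (auto simp: lex_initial_def)

lemma card_lex_initial:
  assumes "s \<le> n choose k"
  shows "card (lex_initial n k s) = s"
proof -
  have fin: "finite A" if "A \<in> nsets {1..n} k" for A
    using that by (simp add: nsets_def)
  have "finite (nsets {1..n} k)" by (simp add: finite_imp_finite_nsets)
  moreover have "s \<le> card (nsets {1..n} k)" using assms by simp
  ultimately show ?thesis
    unfolding lex_initial_def
  proof (rule card_initial_segment)
    show "\<not> lex_less A A" for A by (rule lex_less_irrefl)
    show "lex_less A B \<or> lex_less B A"
      if "A \<in> nsets {1..n} k" "B \<in> nsets {1..n} k" "A \<noteq> B" for A B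
      using lex_less_linear[OF fin[OF that(1)] fin[OF that(2)] that(3)] .
    show "lex_less A D"
      if "A \<in> nsets {1..n} k" "B \<in> nsets {1..n} k" "D \<in> nsets {1..n} k"
        "lex_less A B" "lex_less B D" for A B D
      using lex_less_trans[OF fin[OF that(1)] fin[OF that(2)] fin[OF that(3)] that(4,5)] .
  qed
qed

end

theory Submission
  imports Defs
begin

text \<open>
  Induct on \<open>r\<close>. A full star can be deleted from the family and from the ground set, since the number
  of disjoint pairs between it and the rest depends only on the size of the rest. A family covered by
  \<open>r\<close> points is compared with the lexicographic one through the complement in the union of the \<open>r\<close>
  stars: the lexicographic complement is intersecting and consists of the sets lying in the most
  disjoint pairs.

  There remains an extremal family \<open>F\<close> without full stars. Exchanging a member against a missing
  set shows that each member meets at least \<open>deg i\<close> members, for every point \<open>i\<close>. Let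
  \<open>g A = (\<Sum>i\<in>A. deg i)\<close> and \<open>D = (\<Sum>i. (deg i)\<^sup>2)\<close>, which is the sum of \<open>g\<close> over \<open>F\<close> and bounds the number of
  intersecting pairs. Second moments of \<open>g\<close>, centred over all \<open>k\<close>-sets, first give \<open>D \<le> 2 * card F * S\<close>
  with \<open>S\<close> the size of a star, and then, applied in the link of every point, bound the sum of
  \<open>g\<^sup>2\<close> over \<open>F\<close> by \<open>(\<Sum>i. (deg i)\<^sup>3)\<close> up to a small error; centring is what makes \<open>n\<close> of order \<open>k\<^sup>2\<close> enough.
  By Cauchy--Schwarz \<open>D\<^sup>2 \<le> card F * (\<Sum>i. (deg i)\<^sup>3)\<close> up to that error. As \<open>card F\<close> times the maximal degree
  is at most \<open>D\<close>, nearly all of \<open>D\<close> comes from points of nearly maximal degree. These points cover \<open>F\<close>,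
  because a member missing them would meet too few others, and there are at most \<open>r\<close> of them: if the
  lexicographic family is about \<open>r - 1\<close> stars and a fraction \<open>\<gamma>\<close> of another, then \<open>D\<close> is at least about
  \<open>(r - 1 + \<gamma>\<^sup>2) * S\<^sup>2\<close>, and \<open>(r - 1 + \<gamma>)\<^sup>2 \<le> r * (r - 1 + \<gamma>\<^sup>2)\<close>.
\<close>

section \<open>Disjoint pairs and counting\<close>

definition dis :: "nat set set \<Rightarrow> nat set \<Rightarrow> nat" where
  "dis F A = card {B \<in> F. A \<inter> B = {}}"

lemma dis_insert:
  assumes "finite F" "B \<notin> F"
  shows "dis (insert B F) A = dis F A + (if A \<inter> B = {} then 1 else 0)"
proof -
  have "{X \<in> insert B F. A \<inter> X = {}} =
      (if A \<inter> B = {} then insert B {X \<in> F. A \<inter> X = {}} else {X \<in> F. A \<inter> X = {}})"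
    by auto
  then show ?thesis using assms by (simp add: dis_def)
qed

lemma dis_Un:
  assumes "finite F" "finite H" "F \<inter> H = {}"
  shows "dis (F \<union> H) A = dis F A + dis H A"
proof -
  have "{X \<in> F \<union> H. A \<inter> X = {}} = {X \<in> F. A \<inter> X = {}} \<union> {X \<in> H. A \<inter> X = {}}" by auto
  then show ?thesis unfolding dis_def using assms by (simp add: card_Un_disjoint disjoint_iff)
qed

lemma dp_insert:
  assumes "finite F" "A \<notin> F" "A \<noteq> {}"
  shows "dp (insert A F) = dp F + dis F A"
proof -
  let ?E = "\<lambda>F. {{A, B} | A B. A \<in> F \<and> B \<in> F \<and> A \<noteq> B \<and> A \<inter> B = {}}"
  let ?N = "(\<lambda>B. {A, B}) ` {B \<in> F. A \<inter> B = {}}"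
  have "?E (insert A F) = ?E F \<union> ?N"
  proof
    show "?E (insert A F) \<subseteq> ?E F \<union> ?N"
    proof
      fix e assume "e \<in> ?E (insert A F)"
      then obtain X Y where *: "e = {X, Y}" "X \<in> insert A F" "Y \<in> insert A F" "X \<noteq> Y" "X \<inter> Y = {}"
        by blast
      consider "X = A" | "Y = A" | "X \<noteq> A" "Y \<noteq> A" by blast
      then show "e \<in> ?E F \<union> ?N"
      proof cases
        case 1 then show ?thesis using * by auto
      next
        case 2
        then have "X \<in> F" "A \<inter> X = {}" "e = {A, X}" using * by auto
        then show ?thesis by blast
      next
        case 3 then show ?thesis using * by auto
      qed
    qed
    show "?E F \<union> ?N \<subseteq> ?E (insert A F)" using assms by fastforce
  qed
  moreover have "?E F \<subseteq> Pow F" by blast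
  then have "finite (?E F)" using assms(1) finite_subset by blast
  moreover have "?E F \<inter> ?N = {}" using assms(2) by (auto simp: doubleton_eq_iff)
  moreover have "card ?N = dis F A"
    unfolding dis_def by (rule card_image) (auto simp: inj_on_def doubleton_eq_iff)
  ultimately show ?thesis unfolding dp_def using assms(1) by (simp add: card_Un_disjoint)
qed

lemma dp_empty [simp]: "dp {} = 0"
  by (simp add: dp_def)

lemma dp_Un:
  assumes "finite F" "finite H" "F \<inter> H = {}" "{} \<notin> H"
  shows "dp (F \<union> H) = dp F + dp H + (\<Sum>A\<in>H. dis F A)"
  using assms(2,3,4)
proof (induction H)
  case empty
  then show ?case by simp
next
  case (insert A H)
  have "dp (F \<union> insert A H) = dp (F \<union> H) + dis (F \<union> H) A"
    using dp_insert[of "F \<union> H" A] insert assms(1) by auto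
  also have "\<dots> = dp F + (dp H + dis H A) + (dis F A + (\<Sum>A\<in>H. dis F A))"
    using insert assms(1) by (simp add: dis_Un)
  finally have "dp (F \<union> insert A H) = dp F + (dp H + dis H A) + (dis F A + (\<Sum>A\<in>H. dis F A))" .
  moreover have "dp (insert A H) = dp H + dis H A"
    by (rule dp_insert) (use insert in auto)
  moreover have "(\<Sum>A\<in>insert A H. dis F A) = dis F A + (\<Sum>A\<in>H. dis F A)"
    using insert.hyps by simp
  ultimately show ?case by linarith
qed

text \<open>Each disjoint pair is seen from both of its members. The empty set has to be absent:
  being disjoint from itself, it would be counted by \<open>dis\<close> but not by
  \<open>dp\<close>.\<close>

lemma dp_double:
  assumes "finite F" "{} \<notin> F"
  shows "2 * dp F = (\<Sum>A\<in>F. dis F A)"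
  using assms
proof (induction F)
  case empty
  then show ?case by simp
next
  case (insert A F)
  have "(\<Sum>X\<in>F. dis (insert A F) X) = (\<Sum>X\<in>F. dis F X) + (\<Sum>X\<in>F. if X \<inter> A = {} then 1 else 0)"
    using insert by (simp add: dis_insert sum.distrib)
  moreover have "(\<Sum>X\<in>F. if X \<inter> A = {} then 1 else 0) = dis F A"
    using insert by (simp add: dis_def sum.If_cases Int_commute Int_def)
  moreover have "dp (insert A F) = dp F + dis F A"
    by (rule dp_insert) (use insert in auto)
  moreover have "dis (insert A F) A = dis F A"
    using insert by (auto simp: dis_insert)
  moreover have "(\<Sum>X\<in>insert A F. dis (insert A F) X) = dis (insert A F) A + (\<Sum>X\<in>F. dis (insert A F) X)"
    using insert.hyps by simp
  moreover have "2 * dp F = (\<Sum>X\<in>F. dis F X)" using insert by simp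
  ultimately show ?case by linarith
qed

section \<open>Numbers of k-sets that meet or contain given points\<close>

lemma finite_nsets [simp]: "finite V \<Longrightarrow> finite (nsets V k)"
  by (simp add: finite_imp_finite_nsets)

lemma finite_family:
  assumes "finite V" "F \<subseteq> nsets V k"
  shows "finite F"
  using assms finite_nsets finite_subset by blast

lemma empty_notin_nsets:
  assumes "F \<subseteq> nsets V k" "0 < k"
  shows "{} \<notin> F"
  using assms by (auto simp: nsets_def)

text \<open>The union of the stars at the points of \<open>R\<close>; for \<open>w\<close> in
  \<open>V\<close>, \<open>hit V k {w}\<close> is the full star at \<open>w\<close>.\<close>

definition hit :: "nat set \<Rightarrow> nat \<Rightarrow> nat set \<Rightarrow> nat set set" where
  "hit V k R = {A \<in> nsets V k. A \<inter> R \<noteq> {}}"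

lemma card_disjoint_from:
  assumes "finite V" "R \<subseteq> V"
  shows "card {A \<in> nsets V k. A \<inter> R = {}} = (card V - card R) choose k"
proof -
  have "{A \<in> nsets V k. A \<inter> R = {}} = nsets (V - R) k" by (auto simp: nsets_def)
  then show ?thesis using assms by (simp add: card_Diff_subset finite_subset)
qed

lemma card_hit:
  assumes "finite V" "R \<subseteq> V"
  shows "card (hit V k R) + ((card V - card R) choose k) = card V choose k"
proof -
  have "nsets V k = hit V k R \<union> {A \<in> nsets V k. A \<inter> R = {}}" by (auto simp: hit_def)
  moreover have "card (hit V k R \<union> {A \<in> nsets V k. A \<inter> R = {}}) =
      card (hit V k R) + card {A \<in> nsets V k. A \<inter> R = {}}"
    using assms by (intro card_Un_disjoint) (auto simp: hit_def)
  ultimately show ?thesis using card_disjoint_from[OF assms, of k] card_nsets[of V k] by simp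
qed

lemma card_meet_only:
  assumes "finite V" "R \<subseteq> V" "v \<in> R" "0 < k"
  shows "card {A \<in> nsets V k. A \<inter> R = {v}} = (card V - card R) choose (k - 1)"
proof -
  have "bij_betw (insert v) (nsets (V - R) (k - 1)) {A \<in> nsets V k. A \<inter> R = {v}}"
  proof (rule bij_betw_byWitness[where f' = "\<lambda>A. A - {v}"])
    show "\<forall>A\<in>nsets (V - R) (k - 1). insert v A - {v} = A" using assms by (auto simp: nsets_def)
    show "\<forall>A\<in>{A \<in> nsets V k. A \<inter> R = {v}}. insert v (A - {v}) = A" by auto
    show "insert v ` nsets (V - R) (k - 1) \<subseteq> {A \<in> nsets V k. A \<inter> R = {v}}"
    proof
      fix B assume "B \<in> insert v ` nsets (V - R) (k - 1)"
      then obtain A where A: "A \<subseteq> V - R" "finite A" "card A = k - 1" "B = insert v A"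
        by (auto simp: nsets_def)
      moreover have "v \<notin> A" using A assms(3) by blast
      ultimately have "card B = k" using assms(4) by simp
      then show "B \<in> {A \<in> nsets V k. A \<inter> R = {v}}" using A assms by (auto simp: nsets_def)
    qed
    show "(\<lambda>A. A - {v}) ` {A \<in> nsets V k. A \<inter> R = {v}} \<subseteq> nsets (V - R) (k - 1)"
    proof
      fix B assume "B \<in> (\<lambda>A. A - {v}) ` {A \<in> nsets V k. A \<inter> R = {v}}"
      then obtain A where A: "A \<subseteq> V" "finite A" "card A = k" "A \<inter> R = {v}" "B = A - {v}"
        by (auto simp: nsets_def)
      have "v \<in> A" "A - {v} \<subseteq> V - R" using A(1,4) by blast+
      then show "B \<in> nsets (V - R) (k - 1)" using A(2,3,5) by (simp add: nsets_def)
    qed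
  qed
  then have "card {A \<in> nsets V k. A \<inter> R = {v}} = card (nsets (V - R) (k - 1))"
    by (rule bij_betw_same_card[symmetric])
  also have "\<dots> = (card V - card R) choose (k - 1)"
    using assms(1,2) by (simp add: card_Diff_subset finite_subset)
  finally show ?thesis .
qed

lemma card_containing:
  assumes "finite V" "v \<in> V" "0 < k"
  shows "card {A \<in> nsets V k. v \<in> A} = (card V - 1) choose (k - 1)"
proof -
  have "{A \<in> nsets V k. v \<in> A} = {A \<in> nsets V k. A \<inter> {v} = {v}}" by auto
  then show ?thesis using card_meet_only[of V "{v}" v k] assms by simp
qed

text \<open>Splitting the star of \<open>u\<close> by membership of \<open>v\<close> and applying
  Pascal's rule leaves a single binomial coefficient; absorption then gives this product form, which
  avoids division in \<open>nat\<close>.\<close>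

lemma card_containing_two:
  assumes "finite V" "u \<in> V" "v \<in> V" "u \<noteq> v" "0 < k"
  shows "(card V - 1) * card {A \<in> nsets V k. u \<in> A \<and> v \<in> A} = (k - 1) * ((card V - 1) choose (k - 1))"
proof (cases "k = 1")
  case True
  then have "{A \<in> nsets V k. u \<in> A \<and> v \<in> A} = {}"
    using assms(4) by (auto simp: nsets_def card_1_singleton_iff)
  then have "card {A \<in> nsets V k. u \<in> A \<and> v \<in> A} = 0" by (simp only: card.empty)
  then show ?thesis using True by simp
next
  case False
  then obtain l where l: "k = Suc (Suc l)" using assms(5) by (metis One_nat_def not0_implies_Suc neq0_conv)
  have "card {u, v} \<le> card V" using assms by (intro card_mono) auto
  then obtain N where N: "card V = Suc (Suc N)"
    using assms(4) by (metis card_2_iff add_2_eq_Suc le_Suc_ex)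
  let ?X = "{A \<in> nsets V k. u \<in> A \<and> v \<in> A}"
  have "{A \<in> nsets V k. A \<inter> {u} = {u}} = ?X \<union> {A \<in> nsets V k. A \<inter> {u, v} = {u}}"
    using assms(4) by blast
  moreover have "card (?X \<union> {A \<in> nsets V k. A \<inter> {u, v} = {u}}) =
      card ?X + card {A \<in> nsets V k. A \<inter> {u, v} = {u}}"
    using assms by (intro card_Un_disjoint) auto
  ultimately have "(card V - 1) choose (k - 1) = card ?X + ((card V - 2) choose (k - 1))"
    using card_meet_only[of V "{u}" u k] card_meet_only[of V "{u, v}" u k] assms
    by (simp add: numeral_2_eq_2)
  then have "card ?X = N choose l" using N l by simp
  then show ?thesis using N l Suc_times_binomial_eq[of N l] by (simp add: algebra_simps)
qed

section \<open>Families covered by few points\<close>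

lemma finite_hit [simp]: "finite V \<Longrightarrow> finite (hit V k R)"
  by (simp add: hit_def)

lemma nsets_delete: "nsets (V - {w}) k = {A \<in> nsets V k. w \<notin> A}"
  by (auto simp: nsets_def)

lemma binomial_right_mono:
  assumes "m \<le> n"
  shows "m choose k \<le> n choose k"
proof -
  have "nsets {..<m} k \<subseteq> nsets {..<n} k" using assms by (intro nsets_mono) auto
  then have "card (nsets {..<m} k) \<le> card (nsets {..<n} k)" by (intro card_mono) simp_all
  then show ?thesis by simp
qed

lemma card_hit_insert:
  assumes "finite V" "P \<subseteq> V" "v \<in> V" "v \<notin> P" "0 < k"
  shows "card (hit V k (insert v P)) = card (hit V k P) + ((card V - card (insert v P)) choose (k - 1))"
proof -
  have "hit V k (insert v P) = hit V k P \<union> {A \<in> nsets V k. A \<inter> insert v P = {v}}"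
    using assms(4) by (auto simp: hit_def)
  moreover have "card (hit V k P \<union> {A \<in> nsets V k. A \<inter> insert v P = {v}}) =
      card (hit V k P) + card {A \<in> nsets V k. A \<inter> insert v P = {v}}"
    using assms by (intro card_Un_disjoint) (auto simp: hit_def)
  ultimately show ?thesis using card_meet_only[of V "insert v P" v k] assms by simp
qed

section \<open>Deleting full stars\<close>

lemma dp_intersecting:
  assumes "\<And>A B. A \<in> F \<Longrightarrow> B \<in> F \<Longrightarrow> A \<noteq> B \<Longrightarrow> A \<inter> B \<noteq> {}"
  shows "dp F = 0"
proof -
  have "{{A, B} | A B. A \<in> F \<and> B \<in> F \<and> A \<noteq> B \<and> A \<inter> B = {}} = {}" using assms by blast
  then show ?thesis unfolding dp_def by (simp only: card.empty)
qed

text \<open>The star is intersecting, and every k-set avoiding \<open>w\<close> is disjoint from the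
  same number of its members. Hence only \<open>dp G\<close> and \<open>card G\<close> matter, and
  an induction can pass to the ground set \<open>V - {w}\<close>.\<close>

lemma full_star_split:
  assumes "finite V" "F \<subseteq> nsets V k" "0 < k" "w \<in> V" and star: "hit V k {w} \<subseteq> F"
  defines "G \<equiv> {A \<in> F. w \<notin> A}"
  shows "G \<subseteq> nsets (V - {w}) k"
    and "card F = card G + ((card V - 1) choose (k - 1))"
    and "dp F = dp G + card G * ((card V - 1 - k) choose (k - 1))"
proof -
  let ?S = "hit V k {w}"
  have finF: "finite F" using finite_family assms(1,2) .
  show G: "G \<subseteq> nsets (V - {w}) k" using assms(2) by (auto simp: G_def nsets_def)
  have F: "F = ?S \<union> G" "?S \<inter> G = {}" using star assms(2) by (auto simp: G_def hit_def)
  have fin: "finite ?S" "finite G" using finF star by (auto simp: G_def finite_subset)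
  have cS: "card ?S = (card V - 1) choose (k - 1)"
    using card_hit_insert[of V "{}" w k] assms(1,3,4) by (simp add: hit_def)
  show "card F = card G + ((card V - 1) choose (k - 1))"
    using card_Un_disjoint[OF fin F(2)] cS arg_cong[OF F(1), of card] by linarith
  have "dp ?S = 0" by (rule dp_intersecting) (auto simp: hit_def)
  moreover have "dis ?S A = (card V - 1 - k) choose (k - 1)" if "A \<in> G" for A
  proof -
    have A: "A \<subseteq> V" "w \<notin> A" "card A = k" "finite A" using that G by (auto simp: nsets_def)
    have "{B \<in> ?S. A \<inter> B = {}} = {B \<in> nsets (V - A) k. w \<in> B}"
      by (auto simp: hit_def nsets_def)
    then have "dis ?S A = (card (V - A) - 1) choose (k - 1)"
      using card_containing[of "V - A" w k] assms(1,3,4) A by (simp add: dis_def)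
    also have "card (V - A) - 1 = card V - 1 - k" using A by (simp add: card_Diff_subset)
    finally show ?thesis .
  qed
  moreover have "{} \<notin> G" using empty_notin_nsets[OF G assms(3)] .
  ultimately show "dp F = dp G + card G * ((card V - 1 - k) choose (k - 1))"
    using dp_Un[OF fin F(2)] arg_cong[OF F(1), of dp] by simp
qed

text \<open>The number of disjoint pairs in a family of \<open>k\<close>-subsets of an \<open>n\<close>-set that consists of \<open>r - 1\<close> full
  stars and all but \<open>h\<close> of the remaining sets of one further star. The recursion deletes a full star.\<close>
fun lex_value :: "nat \<Rightarrow> nat \<Rightarrow> nat \<Rightarrow> nat \<Rightarrow> nat" where
  "lex_value k 0 n h = 0"
| "lex_value k (Suc r) n h = lex_value k r (n - 1) h +
     (((n - 1) choose k) - ((n - 1 - r) choose k) - h) * ((n - 1 - k) choose (k - 1))"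

text \<open>Peeling off the stars at the points of \<open>P\<close> one by one leaves sets that all
  contain \<open>v\<close>, hence no disjoint pair. The value does not depend on which
  \<open>h\<close> sets are missing.\<close>

lemma dp_lex_like:
  assumes "finite V" "0 < k" "insert v P \<subseteq> V" "v \<notin> P"
    "hit V k P \<subseteq> F" "F \<subseteq> hit V k (insert v P)"
    "card F + h = card (hit V k (insert v P))"
  shows "dp F = lex_value k (Suc (card P)) (card V) h"
proof -
  have "finite P" using assms(1,3) finite_subset[of P V] by simp
  then show ?thesis using assms
  proof (induction P arbitrary: V F rule: finite_induct)
    case empty
    have "v \<in> A" if "A \<in> F" for A using that empty.prems(6) by (auto simp: hit_def)
    then have "dp F = 0" by (intro dp_intersecting) blast
    \<comment> \<open>The factor in \<open>lex_value\<close> is \<open>0 - h\<close>, which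
      truncated subtraction makes \<open>0\<close>.\<close>
    then show ?case by simp
  next
    case (insert w P)
    have FV: "F \<subseteq> nsets V k" using insert.prems(6) by (auto simp: hit_def)
    have wV: "w \<in> V" using insert.prems(3) by auto
    have star: "hit V k {w} \<subseteq> F" using insert.prems(5) by (auto simp: hit_def)
    let ?G = "{A \<in> F. w \<notin> A}"
    let ?W = "V - {w}"
    note split = full_star_split[OF insert.prems(1) FV insert.prems(2) wV star]
    have sub: "insert v P \<subseteq> ?W" using insert.prems(3,4) insert.hyps(2) by auto
    have cW: "card ?W = card V - 1" using wV by simp
    have cP: "card (insert v P) = Suc (card P)"
      using insert.hyps(1) insert.prems(4) by simp
    \<comment> \<open>The family and the full union both lose exactly the star of \<open>w\<close>,
      so \<open>h\<close> stays the same.\<close>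
    have eq: "card ?G + h = card (hit ?W k (insert v P))"
    proof -
      have "hit V k (insert v (insert w P)) = hit V k {w} \<union> hit ?W k (insert v P)"
        unfolding hit_def nsets_delete by blast
      moreover have "card (hit V k {w} \<union> hit ?W k (insert v P)) =
          card (hit V k {w}) + card (hit ?W k (insert v P))"
        using insert.prems(1) by (intro card_Un_disjoint finite_hit) (auto simp: hit_def nsets_delete)
      moreover have "card (hit V k {w}) = (card V - 1) choose (k - 1)"
        using card_hit_insert[of V "{}" w k] insert.prems(1,2) wV by (simp add: hit_def)
      ultimately have "card (hit V k (insert v (insert w P))) =
          ((card V - 1) choose (k - 1)) + card (hit ?W k (insert v P))" by simp
      then show ?thesis using split(2) insert.prems(7) by linarith
    qed
    have "dp ?G = lex_value k (Suc (card P)) (card ?W) h"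
    proof (rule insert.IH)
      show "hit ?W k P \<subseteq> ?G" using insert.prems(5) by (auto simp: hit_def nsets_delete)
      show "?G \<subseteq> hit ?W k (insert v P)" using insert.prems(6) by (auto simp: hit_def nsets_delete)
      show "finite ?W" using insert.prems(1) by simp
      show "v \<notin> P" using insert.prems(4) by simp
    qed (fact insert.prems(2) sub eq)+
    moreover have "card ?G = ((card V - 1) choose k) - ((card V - 1 - Suc (card P)) choose k) - h"
      using eq card_hit[OF _ sub, of k] insert.prems(1) unfolding cW cP by simp
    moreover have "card (insert w P) = Suc (card P)" using insert.hyps by simp
    ultimately show ?case unfolding split(3) by (simp only: cW lex_value.simps(2))
  qed
qed

text \<open>The members disjoint from \<open>A\<close> are the k-subsets of \<open>V - A\<close>
  that meet \<open>R - A\<close>. There are most of them when \<open>R - A\<close> is largest, that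
  is, when \<open>A\<close> meets \<open>R\<close> in a single point.\<close>

lemma dis_hit_le:
  assumes "finite V" "R \<subseteq> V" "A \<in> hit V k R"
  shows "dis (hit V k R) A + ((card V - k - (card R - 1)) choose k) \<le> (card V - k) choose k"
    and "card (A \<inter> R) = 1 \<Longrightarrow>
      dis (hit V k R) A + ((card V - k - (card R - 1)) choose k) = (card V - k) choose k"
proof -
  have A: "A \<subseteq> V" "finite A" "card A = k" "A \<inter> R \<noteq> {}" using assms(3) by (auto simp: hit_def nsets_def)
  have finR: "finite R" using assms(1,2) finite_subset by blast
  have "{B \<in> hit V k R. A \<inter> B = {}} = hit (V - A) k (R - A)"
    by (auto simp: hit_def nsets_def)
  then have *: "dis (hit V k R) A + ((card V - k - card (R - A)) choose k) = (card V - k) choose k"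
    using card_hit[of "V - A" "R - A" k] assms(1,2) A by (simp add: dis_def card_Diff_subset Diff_mono)
  have cR: "card (R - A) + card (A \<inter> R) = card R"
    using card_Int_Diff[OF finR, of A] by (simp add: Int_commute)
  have "card (A \<inter> R) \<ge> 1" using A(4) finR by (simp add: Suc_leI card_gt_0_iff)
  then have "card R - 1 \<ge> card (R - A)" using cR by linarith
  then have "(card V - k - (card R - 1)) choose k \<le> (card V - k - card (R - A)) choose k"
    by (intro binomial_right_mono diff_le_mono2)
  then show "dis (hit V k R) A + ((card V - k - (card R - 1)) choose k) \<le> (card V - k) choose k"
    using * by linarith
  assume "card (A \<inter> R) = 1"
  then have "card R - 1 = card (R - A)" using cR by linarith
  then show "dis (hit V k R) A + ((card V - k - (card R - 1)) choose k) = (card V - k) choose k"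
    using * by simp
qed

text \<open>The sum over \<open>H\<close> counts a pair inside \<open>H\<close> twice, so
  \<open>dp H\<close> restores the surplus.\<close>

lemma dp_Diff:
  assumes "finite U" "H \<subseteq> U" "{} \<notin> U"
  shows "dp (U - H) + (\<Sum>A\<in>H. dis U A) = dp U + dp H"
proof -
  have fin: "finite (U - H)" "finite H" using assms finite_subset by auto
  have U: "U = (U - H) \<union> H" "(U - H) \<inter> H = {}" using assms(2) by auto
  have "{} \<notin> H" using assms by auto
  have "dp U = dp (U - H) + dp H + (\<Sum>A\<in>H. dis (U - H) A)"
    using dp_Un[OF fin U(2) \<open>{} \<notin> H\<close>] arg_cong[OF U(1), of dp] by linarith
  moreover have "(\<Sum>A\<in>H. dis U A) = (\<Sum>A\<in>H. dis (U - H) A) + (\<Sum>A\<in>H. dis H A)"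
    unfolding sum.distrib[symmetric] dis_Un[OF fin U(2), symmetric] U(1)[symmetric] ..
  moreover have "(\<Sum>A\<in>H. dis H A) = 2 * dp H"
    using dp_double[OF fin(2) \<open>{} \<notin> H\<close>] by simp
  ultimately show ?thesis by linarith
qed

text \<open>The comparison family. All its missing sets meet \<open>R\<close> in \<open>v\<close>
  alone, so they intersect each other and lie in the most disjoint pairs of the union of stars; the
  bound on \<open>h\<close> says that there are enough such sets.\<close>

lemma lex_like_exists:
  assumes "finite V" "0 < k" "R \<subseteq> V" "v \<in> R" "h \<le> (card V - card R) choose (k - 1)"
  obtains H where "H \<subseteq> {A \<in> nsets V k. A \<inter> R = {v}}" "card H = h"
    "hit V k (R - {v}) \<subseteq> hit V k R - H"
    "card (hit V k R - H) + h = card (hit V k R)"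
    "dp (hit V k R - H) = lex_value k (card R) (card V) h"
proof -
  have finR: "finite R" using assms(1,3) finite_subset by blast
  obtain H where H: "H \<subseteq> {A \<in> nsets V k. A \<inter> R = {v}}" "card H = h" "finite H"
    using obtain_subset_with_card_n[of h "{A \<in> nsets V k. A \<inter> R = {v}}"]
    unfolding card_meet_only[OF assms(1,3,4,2)] using assms(5) by blast
  have U: "H \<subseteq> hit V k R" using H(1) by (auto simp: hit_def)
  have finU: "finite (hit V k R)" using assms(1) by (simp add: hit_def)
  have c: "card (hit V k R - H) + h = card (hit V k R)"
    using card_Diff_subset[OF H(3) U] card_mono[OF finU U] H(2) by simp
  have sub: "hit V k (R - {v}) \<subseteq> hit V k R - H" using H(1) by (auto simp: hit_def)
  have ins: "insert v (R - {v}) = R" using assms(4) by auto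
  have "dp (hit V k R - H) = lex_value k (Suc (card (R - {v}))) (card V) h"
    using dp_lex_like[of V k v "R - {v}" "hit V k R - H" h, unfolded ins] assms(1-3) sub c
    by blast
  moreover have "Suc (card (R - {v})) = card R" using card_Suc_Diff1[OF finR assms(4)] .
  ultimately have "dp (hit V k R - H) = lex_value k (card R) (card V) h" by simp
  then show ?thesis by (rule that[OF H(1,2) sub c])
qed

text \<open>Both \<open>F\<close> and the comparison family arise from the union of stars by
  removing \<open>h\<close> sets. By \<open>dp_Diff\<close> the best removal has the largest sum of
  \<open>dis\<close> and no disjoint pair inside, and the comparison family achieves both.\<close>

lemma dp_ge_if_covered:
  assumes "finite V" "0 < k" "R \<subseteq> V" "R \<noteq> {}" "F \<subseteq> hit V k R"
    "card F + h = card (hit V k R)" "h \<le> (card V - card R) choose (k - 1)"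
  shows "lex_value k (card R) (card V) h \<le> dp F"
proof -
  let ?U = "hit V k R"
  let ?M = "((card V - k) choose k) - ((card V - k - (card R - 1)) choose k)"
  obtain v where v: "v \<in> R" using assms(4) by blast
  have fin: "finite ?U" using assms(1) by simp
  have ne: "{} \<notin> ?U" by (simp add: hit_def)
  obtain H where H: "H \<subseteq> {A \<in> nsets V k. A \<inter> R = {v}}" "card H = h"
      "dp (?U - H) = lex_value k (card R) (card V) h"
    using lex_like_exists[OF assms(1,2,3) v assms(7)] .
  have HU: "H \<subseteq> ?U" using H(1) by (auto simp: hit_def)
  have "dp H = 0" by (rule dp_intersecting) (use H(1) in blast)
  moreover have "dis ?U A = ?M" if "A \<in> H" for A
    using dis_hit_le(2)[OF assms(1,3)] that HU H(1) by fastforce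
  ultimately have ref: "lex_value k (card R) (card V) h + h * ?M = dp ?U"
    using dp_Diff[OF fin HU ne] H by simp
  let ?L = "?U - F"
  have L: "?U - ?L = F" "card ?L = h"
    using assms(6) card_Diff_subset[OF finite_subset[OF assms(5) fin] assms(5)]
    by (simp_all add: double_diff[OF assms(5)])
  have "(\<Sum>A\<in>?L. dis ?U A) \<le> (\<Sum>A\<in>?L. ?M)"
  proof (rule sum_mono)
    show "dis ?U A \<le> ?M" if "A \<in> ?L" for A
      using dis_hit_le(1)[OF assms(1,3), of A k] that by fastforce
  qed
  then have "(\<Sum>A\<in>?L. dis ?U A) \<le> h * ?M" using L(2) by simp
  moreover have "dp F + (\<Sum>A\<in>?L. dis ?U A) = dp ?U + dp ?L"
    using dp_Diff[OF fin _ ne, of ?L] L(1) by auto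
  ultimately show ?thesis using ref by linarith
qed

section \<open>Degrees and second moments\<close>

definition deg :: "nat set set \<Rightarrow> nat \<Rightarrow> nat" where
  "deg F i = card {A \<in> F. i \<in> A}"

text \<open>A nonempty member \<open>A\<close> of \<open>F\<close> is itself counted, so summing
  over \<open>F\<close> counts ordered pairs with the diagonal.\<close>

definition meet :: "nat set set \<Rightarrow> nat set \<Rightarrow> nat" where
  "meet F A = card {B \<in> F. A \<inter> B \<noteq> {}}"

lemma meet_plus_dis:
  assumes "finite F"
  shows "meet F A + dis F A = card F"
proof -
  have "F = {B \<in> F. A \<inter> B \<noteq> {}} \<union> {B \<in> F. A \<inter> B = {}}" by auto
  moreover have "card ({B \<in> F. A \<inter> B \<noteq> {}} \<union> {B \<in> F. A \<inter> B = {}}) = meet F A + dis F A"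
    unfolding meet_def dis_def using assms by (intro card_Un_disjoint) auto
  ultimately show ?thesis by simp
qed

lemma sum_meet_plus_dp:
  assumes "finite F" "{} \<notin> F"
  shows "(\<Sum>A\<in>F. meet F A) + 2 * dp F = card F * card F"
proof -
  have "(\<Sum>A\<in>F. meet F A) + (\<Sum>A\<in>F. dis F A) = card F * card F"
    using meet_plus_dis[OF assms(1)] by (simp add: sum.distrib[symmetric])
  then show ?thesis using dp_double[OF assms] by simp
qed

lemma meet_le_sum_deg:
  assumes "finite F" "finite A"
  shows "meet F A \<le> (\<Sum>i\<in>A. deg F i)"
proof -
  have "{B \<in> F. A \<inter> B \<noteq> {}} = (\<Union>i\<in>A. {B \<in> F. i \<in> B})" by auto
  then show ?thesis unfolding meet_def deg_def using card_UN_le[OF assms(2)] by simp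
qed

lemma sum_members:
  fixes f :: "nat \<Rightarrow> nat set \<Rightarrow> real"
  assumes "finite V" "F \<subseteq> nsets V k"
  shows "(\<Sum>A\<in>F. \<Sum>i\<in>A. f i A) = (\<Sum>i\<in>V. \<Sum>A | A \<in> F \<and> i \<in> A. f i A)"
proof -
  have "(\<Sum>A\<in>F. \<Sum>i\<in>A. f i A) = (\<Sum>A\<in>F. \<Sum>i | i \<in> V \<and> i \<in> A. f i A)"
    using assms(2) by (intro sum.cong) (auto simp: nsets_def)
  also have "\<dots> = (\<Sum>i\<in>V. \<Sum>A | A \<in> F \<and> i \<in> A. f i A)"
    using sum.swap_restrict[OF finite_family[OF assms] assms(1), of "\<lambda>A i. f i A" "\<lambda>A i. i \<in> A"] .
  finally show ?thesis .
qed

lemma sum_members_deg: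
  fixes w :: "nat \<Rightarrow> real"
  assumes "finite V" "F \<subseteq> nsets V k"
  shows "(\<Sum>A\<in>F. \<Sum>i\<in>A. w i) = (\<Sum>i\<in>V. deg F i * w i)"
  using sum_members[OF assms, of "\<lambda>i A. w i"] by (simp add: deg_def)

lemma sum_deg:
  assumes "finite V" "F \<subseteq> nsets V k"
  shows "(\<Sum>i\<in>V. real (deg F i)) = k * card F"
proof -
  have "(\<Sum>A\<in>F. \<Sum>i\<in>A. 1::real) = (\<Sum>A\<in>F. real k)"
    using assms(2) by (intro sum.cong) (auto simp: nsets_def)
  then show ?thesis using sum_members_deg[OF assms, of "\<lambda>i. 1"] by (simp add: mult.commute)
qed

section \<open>Pair degrees and second moments over all k-sets\<close>

lemma codegree:
  assumes "finite V" "u \<in> V" "v \<in> V" "u \<noteq> v" "0 < k"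
  shows "real (card {A \<in> nsets V k. u \<in> A \<and> v \<in> A}) =
    (real k - 1) / (real (card V) - 1) * real ((card V - 1) choose (k - 1))"
proof -
  have "card {u, v} \<le> card V" using assms by (intro card_mono) auto
  then have V: "2 \<le> card V" using assms(4) by simp
  have "real ((card V - 1) * card {A \<in> nsets V k. u \<in> A \<and> v \<in> A})
      = real ((k - 1) * ((card V - 1) choose (k - 1)))"
    using card_containing_two[OF assms] by simp
  then have "(real (card V) - 1) * real (card {A \<in> nsets V k. u \<in> A \<and> v \<in> A})
      = (real k - 1) * real ((card V - 1) choose (k - 1))"
    using V assms(5) by (simp add: of_nat_diff)
  then show ?thesis using V by (simp add: field_simps)
qed

text \<open>On expanding the square, a single point lies in \<open>S\<close> sets and a pair of
  distinct points in \<open>q * S\<close> sets.\<close>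

lemma sum_square_weights:
  fixes w :: "nat \<Rightarrow> real"
  assumes "finite V" "0 < k"
  defines "S \<equiv> real ((card V - 1) choose (k - 1))" and "q \<equiv> (real k - 1) / (real (card V) - 1)"
  shows "(\<Sum>A\<in>nsets V k. (\<Sum>i\<in>A. w i)\<^sup>2) =
    S * (\<Sum>i\<in>V. (w i)\<^sup>2) + q * S * ((\<Sum>i\<in>V. w i)\<^sup>2 - (\<Sum>i\<in>V. (w i)\<^sup>2))"
proof -
  let ?K = "nsets V k"
  have inner: "(\<Sum>A | A \<in> ?K \<and> i \<in> A. w i * (\<Sum>j\<in>A. w j)) =
      S * (w i)\<^sup>2 + q * S * (w i * (\<Sum>j\<in>V. w j) - (w i)\<^sup>2)" if i: "i \<in> V" for i
  proof -
    have "(\<Sum>A | A \<in> ?K \<and> i \<in> A. \<Sum>j\<in>A. w j) =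
        (\<Sum>j\<in>V. real (card {A \<in> ?K. i \<in> A \<and> j \<in> A}) * w j)"
    proof -
      have "{A \<in> ?K. i \<in> A} \<subseteq> ?K" by blast
      then show ?thesis
        using sum_members_deg[OF assms(1), of "{A \<in> ?K. i \<in> A}" k w] by (simp add: deg_def)
    qed
    also have "\<dots> = real (card {A \<in> ?K. i \<in> A}) * w i +
        (\<Sum>j\<in>V - {i}. real (card {A \<in> ?K. i \<in> A \<and> j \<in> A}) * w j)"
      using assms(1) i by (simp add: sum.remove)
    also have "(\<Sum>j\<in>V - {i}. real (card {A \<in> ?K. i \<in> A \<and> j \<in> A}) * w j) = (\<Sum>j\<in>V - {i}. q * S * w j)"
    proof (rule sum.cong)
      fix j assume "j \<in> V - {i}"
      then show "real (card {A \<in> ?K. i \<in> A \<and> j \<in> A}) * w j = q * S * w j"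
        using codegree[OF assms(1) i, of j k] assms(2) unfolding S_def q_def by simp
    qed simp
    also have "\<dots> = q * S * ((\<Sum>j\<in>V. w j) - w i)"
      using assms(1) i by (simp add: sum_distrib_left[symmetric] sum_diff1)
    also have "real (card {A \<in> ?K. i \<in> A}) = S"
      using card_containing[OF assms(1) i assms(2)] by (simp add: S_def)
    finally have "(\<Sum>A | A \<in> ?K \<and> i \<in> A. \<Sum>j\<in>A. w j) = S * w i + q * S * ((\<Sum>j\<in>V. w j) - w i)" .
    then show ?thesis
      unfolding sum_distrib_left[symmetric] by (simp add: power2_eq_square right_diff_distrib distrib_left)
  qed
  have "(\<Sum>A\<in>?K. (\<Sum>i\<in>A. w i)\<^sup>2) = (\<Sum>A\<in>?K. \<Sum>i\<in>A. w i * (\<Sum>j\<in>A. w j))"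
    by (simp add: power2_eq_square sum_distrib_right)
  also have "\<dots> = (\<Sum>i\<in>V. \<Sum>A | A \<in> ?K \<and> i \<in> A. w i * (\<Sum>j\<in>A. w j))"
    using sum_members[OF assms(1), of ?K k] by simp
  also have "\<dots> = (\<Sum>i\<in>V. S * (w i)\<^sup>2 + q * S * (w i * (\<Sum>j\<in>V. w j) - (w i)\<^sup>2))"
    using inner by (rule sum.cong[OF refl])
  also have "\<dots> = S * (\<Sum>i\<in>V. (w i)\<^sup>2) + q * S * ((\<Sum>i\<in>V. w i)\<^sup>2 - (\<Sum>i\<in>V. (w i)\<^sup>2))"
    by (simp add: sum.distrib sum_subtractf sum_distrib_left[symmetric] sum_distrib_right[symmetric]
        power2_eq_square)
  finally show ?thesis .
qed

text \<open>Chebyshev's idea: the weight of a set is centred at its mean \<open>c\<close> over all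
  k-sets, and the sum of squared deviations over \<open>G\<close> is at most that over all k-sets,
  hence at most \<open>S\<close> times the sum of the squared weights. The parameter \<mu> trades
  the linear term against the quadratic one.\<close>

lemma variance_bound:
  fixes w :: "nat \<Rightarrow> real"
  assumes "finite V" "0 < k" "k \<le> card V" "G \<subseteq> nsets V k" "0 < \<mu>"
  defines "S \<equiv> real ((card V - 1) choose (k - 1))"
  shows "(\<Sum>A\<in>G. \<Sum>i\<in>A. w i) \<le>
    card G * (k * (\<Sum>i\<in>V. w i) / card V + \<mu>) + S * (\<Sum>i\<in>V. (w i)\<^sup>2) / (4 * \<mu>)"
proof -
  let ?K = "nsets V k"
  define g where "g A = (\<Sum>i\<in>A. w i)" for A :: "nat set"
  define W where "W = (\<Sum>i\<in>V. w i)"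
  define Q where "Q = (\<Sum>i\<in>V. (w i)\<^sup>2)"
  define q where "q = (real k - 1) / (real (card V) - 1)"
  define n where "n = real (card V)"
  define c where "c = k * W / n"
  have n: "1 \<le> real k" "real k \<le> n" using assms(2,3) by (auto simp: n_def)
  have Q: "0 \<le> Q" unfolding Q_def by (rule sum_nonneg) simp
  have S0: "0 \<le> S" by (simp add: S_def)
  have q: "0 \<le> q" "q \<le> k / n"
  proof -
    show "0 \<le> q" using n by (simp add: q_def n_def)
    show "q \<le> k / n"
    proof (cases "n = 1")
      \<comment> \<open>Here the denominator of \<open>q\<close> is zero, so
        \<open>q = 0\<close>.\<close>
      case True
      then show ?thesis using n by (simp add: q_def n_def)
    next
      case False
      then show ?thesis using n unfolding q_def n_def[symmetric] by (simp add: field_simps)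
    qed
  qed
  have m1: "(\<Sum>A\<in>?K. g A) = S * W"
  proof -
    have "(\<Sum>A\<in>?K. g A) = (\<Sum>i\<in>V. real (deg ?K i) * w i)"
      unfolding g_def using sum_members_deg[OF assms(1)] by blast
    also have "\<dots> = (\<Sum>i\<in>V. S * w i)"
      using card_containing[OF assms(1) _ assms(2)] by (intro sum.cong) (auto simp: deg_def S_def)
    finally show ?thesis by (simp add: W_def sum_distrib_left)
  qed
  have m2: "(\<Sum>A\<in>?K. (g A)\<^sup>2) = S * Q + q * S * (W\<^sup>2 - Q)"
    using sum_square_weights[OF assms(1,2), of w] unfolding g_def W_def Q_def S_def q_def .
  have m0: "real (card ?K) * k = n * S"
  proof -
    have "k * (card V choose k) = card V * ((card V - 1) choose (k - 1))"
      using times_binomial_minus1_eq assms(2) by blast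
    then show ?thesis unfolding n_def S_def
      by (metis card_nsets mult.commute of_nat_mult)
  qed
  have "(\<Sum>A\<in>?K. (g A - c)\<^sup>2) = (\<Sum>A\<in>?K. (g A)\<^sup>2 - 2 * c * g A + c\<^sup>2)"
    by (intro sum.cong) (auto simp: power2_diff)
  also have "\<dots> = S * Q + q * S * (W\<^sup>2 - Q) - 2 * c * (S * W) + card ?K * c\<^sup>2"
    by (simp add: sum.distrib sum_subtractf sum_distrib_left[symmetric] m1 m2 del: card_nsets)
  also have "card ?K * c\<^sup>2 = (real (card ?K) * k) * W * c / n"
    by (simp add: c_def power2_eq_square)
  also have "\<dots> = (n * S) * W * c / n" by (simp only: m0)
  also have "\<dots> = S * W * c" using n by simp
  also have "S * Q + q * S * (W\<^sup>2 - Q) - 2 * c * (S * W) + S * W * c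
      = S * Q - q * S * Q - S * W\<^sup>2 * (k / n - q)"
    by (simp add: c_def power2_eq_square algebra_simps)
  \<comment> \<open>Centring pays off here: the terms in \<open>W\<^sup>2\<close> nearly cancel, and
    what remains has the right sign because \<open>q \<le> k / n\<close>.\<close>
  also have "\<dots> \<le> S * Q"
  proof -
    have "0 \<le> q * S * Q" "0 \<le> S * W\<^sup>2 * (k / n - q)" using q Q S0 by simp_all
    then show ?thesis by linarith
  qed
  finally have var: "(\<Sum>A\<in>?K. (g A - c)\<^sup>2) \<le> S * Q" .
  \<comment> \<open>With \<open>x = g A - c\<close>, this is
    \<open>(x - 2 * \<mu>)\<^sup>2 \<ge> 0\<close> rearranged to bound \<open>x\<close> by a
    quadratic.\<close>
  have pt: "g A \<le> (c + \<mu>) + (g A - c)\<^sup>2 / (4 * \<mu>)" for A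
  proof -
    have "0 \<le> (g A - c - 2 * \<mu>)\<^sup>2" by simp
    then have "4 * \<mu> * (g A - c - \<mu>) \<le> (g A - c)\<^sup>2"
      by (simp add: power2_eq_square algebra_simps)
    then have "g A - c - \<mu> \<le> (g A - c)\<^sup>2 / (4 * \<mu>)" using assms(5) by (simp add: field_simps)
    then show ?thesis by simp
  qed
  have "(\<Sum>A\<in>G. g A) \<le> (\<Sum>A\<in>G. (c + \<mu>) + (g A - c)\<^sup>2 / (4 * \<mu>))"
    by (intro sum_mono pt)
  also have "\<dots> = card G * (c + \<mu>) + (\<Sum>A\<in>G. (g A - c)\<^sup>2) / (4 * \<mu>)"
    by (simp add: sum.distrib sum_divide_distrib)
  also have "(\<Sum>A\<in>G. (g A - c)\<^sup>2) \<le> (\<Sum>A\<in>?K. (g A - c)\<^sup>2)"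
    using assms(1,4) by (intro sum_mono2) auto
  then have "(\<Sum>A\<in>G. (g A - c)\<^sup>2) / (4 * \<mu>) \<le> S * Q / (4 * \<mu>)"
    using var assms(5) by (intro divide_right_mono) auto
  finally show ?thesis unfolding g_def c_def W_def Q_def n_def by simp
qed

text \<open>\<open>variance_bound\<close> in the link of \<open>i\<close>, a family of (k-1)-sets on
  \<open>V - {i}\<close>. There both the star size and the mean shrink: the star size is the pair
  degree \<open>q * S\<close>, and the mean is \<open>q\<close> times the total weight.\<close>

lemma link_bound:
  fixes w :: "nat \<Rightarrow> real"
  assumes "finite V" "0 < k" "k \<le> card V" "F \<subseteq> nsets V k" "0 < \<mu>" "i \<in> V"
    and w: "\<And>j. j \<in> V \<Longrightarrow> 0 \<le> w j"
  defines "S \<equiv> real ((card V - 1) choose (k - 1))" and "q \<equiv> (real k - 1) / (real (card V) - 1)"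
  shows "(\<Sum>A | A \<in> F \<and> i \<in> A. \<Sum>j\<in>A - {i}. w j) \<le>
    deg F i * (q * (\<Sum>j\<in>V. w j) + \<mu>) + q * S * (\<Sum>j\<in>V. (w j)\<^sup>2) / (4 * \<mu>)"
\<comment> \<open>For \<open>k = 1\<close> the link consists of empty sets, which
  \<open>variance_bound\<close> does not cover.\<close>
proof (cases "k = 1")
  case True
  have "(\<Sum>A | A \<in> F \<and> i \<in> A. \<Sum>j\<in>A - {i}. w j) = (\<Sum>A | A \<in> F \<and> i \<in> A. 0)"
  proof (rule sum.cong)
    fix A assume "A \<in> {A \<in> F. i \<in> A}"
    then have "card A = 1" "i \<in> A" using assms(4) True by (auto simp: nsets_def)
    then have "A - {i} = {}" by (auto simp: card_1_singleton_iff)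
    then show "(\<Sum>j\<in>A - {i}. w j) = 0" by (simp only: sum.empty)
  qed simp
  then show ?thesis using True assms(5) by (simp add: q_def)
next
  case False
  let ?G = "(\<lambda>A. A - {i}) ` {A \<in> F. i \<in> A}" and ?V = "V - {i}"
  have k2: "2 \<le> k" using False assms(2) by simp
  have cV: "card ?V = card V - 1" using assms(1,6) by simp
  have inj: "inj_on (\<lambda>A. A - {i}) {A \<in> F. i \<in> A}" by (auto simp: inj_on_def)
  have cG: "card ?G = deg F i" unfolding deg_def by (rule card_image[OF inj])
  have GV: "?G \<subseteq> nsets ?V (k - 1)" using assms(4) by (auto simp: nsets_def)
  have q0: "0 \<le> q" using k2 assms(3) by (simp add: q_def)
  have S': "real ((card ?V - 1) choose (k - 1 - 1)) = q * S"
  proof -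
    have "(k - 1) * ((card V - 1) choose (k - 1)) = (card V - 1) * ((card V - 2) choose (k - 2))"
      using times_binomial_minus1_eq[of "k - 1" "card V - 1"] k2 by (simp add: numeral_2_eq_2)
    then have "real ((k - 1) * ((card V - 1) choose (k - 1))) = real ((card V - 1) * ((card V - 2) choose (k - 2)))"
      by simp
    then have "(real k - 1) * S = (real (card V) - 1) * real ((card V - 2) choose (k - 2))"
      using k2 assms(3) by (simp add: S_def of_nat_diff)
    then show ?thesis using k2 assms(3) cV by (simp add: q_def field_simps numeral_2_eq_2)
  qed
  have W: "(\<Sum>j\<in>?V. w j) \<le> (\<Sum>j\<in>V. w j)" using assms(1) w by (intro sum_mono2) auto
  have Q: "(\<Sum>j\<in>?V. (w j)\<^sup>2) \<le> (\<Sum>j\<in>V. (w j)\<^sup>2)" using assms(1) by (intro sum_mono2) auto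
  have "(\<Sum>A | A \<in> F \<and> i \<in> A. \<Sum>j\<in>A - {i}. w j) = (\<Sum>A\<in>?G. \<Sum>j\<in>A. w j)"
    by (simp add: sum.reindex[OF inj])
  also have "\<dots> \<le> card ?G * (real (k - 1) * (\<Sum>j\<in>?V. w j) / card ?V + \<mu>) +
      real ((card ?V - 1) choose (k - 1 - 1)) * (\<Sum>j\<in>?V. (w j)\<^sup>2) / (4 * \<mu>)"
    using variance_bound[OF _ _ _ GV assms(5), of w] assms(1,3) k2 cV by simp
  also have "\<dots> = deg F i * (q * (\<Sum>j\<in>?V. w j) + \<mu>) + q * S * (\<Sum>j\<in>?V. (w j)\<^sup>2) / (4 * \<mu>)"
  proof -
    have "real (k - 1) * x / card ?V = q * x" for x
      unfolding cV q_def using k2 assms(3) by (simp add: of_nat_diff)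
    then show ?thesis by (simp only: S' cG)
  qed
  also have "\<dots> \<le> deg F i * (q * (\<Sum>j\<in>V. w j) + \<mu>) + q * S * (\<Sum>j\<in>V. (w j)\<^sup>2) / (4 * \<mu>)"
  proof (rule add_mono)
    show "deg F i * (q * (\<Sum>j\<in>?V. w j) + \<mu>) \<le> deg F i * (q * (\<Sum>j\<in>V. w j) + \<mu>)"
      using W q0 by (intro mult_left_mono add_right_mono) auto
    show "q * S * (\<Sum>j\<in>?V. (w j)\<^sup>2) / (4 * \<mu>) \<le> q * S * (\<Sum>j\<in>V. (w j)\<^sup>2) / (4 * \<mu>)"
      using Q q0 assms(5) by (intro divide_right_mono mult_left_mono) (auto simp: S_def)
  qed
  finally show ?thesis .
qed

text \<open>The left side is the sum over \<open>F\<close> of the degree weight. In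
  \<open>variance_bound\<close> with \<mu> equal to \<open>S / 2\<close> the error term is half of
  the left side again and can be absorbed.\<close>

lemma sum_deg_square_le:
  fixes S :: real
  assumes "finite V" "0 < k" "k \<le> card V" "F \<subseteq> nsets V k"
  defines "S \<equiv> real ((card V - 1) choose (k - 1))"
  assumes small: "2 * real k ^ 2 * card F \<le> S * card V"
  shows "(\<Sum>i\<in>V. (real (deg F i))\<^sup>2) \<le> 2 * card F * S"
proof -
  define D where "D = (\<Sum>i\<in>V. (real (deg F i))\<^sup>2)"
  define n where "n = real (card V)"
  define s where "s = real (card F)"
  have n0: "0 < n" using assms(2,3) by (simp add: n_def)
  have S0: "0 < S" using assms(2,3) by (simp add: S_def)
  have "D = (\<Sum>A\<in>F. \<Sum>i\<in>A. real (deg F i))"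
    using sum_members_deg[OF assms(1,4), of "\<lambda>i. real (deg F i)"] by (simp add: D_def power2_eq_square)
  also have "\<dots> \<le> s * (k * (k * s) / n + S / 2) + S * D / (4 * (S / 2))"
    using variance_bound[OF assms(1-4), of "S / 2" "\<lambda>i. real (deg F i)"] S0
    unfolding sum_deg[OF assms(1,4)] D_def n_def s_def S_def by simp
  also have "S * D / (4 * (S / 2)) = D / 2" using S0 by simp
  also have "k * (k * s) / n \<le> S / 2"
    using small n0 unfolding n_def[symmetric] s_def[symmetric]
    by (simp add: field_simps power2_eq_square)
  then have "k * (k * s) / n + S / 2 \<le> S" by linarith
  then have "s * (k * (k * s) / n + S / 2) \<le> s * S"
    by (rule mult_left_mono) (simp add: s_def)
  finally show ?thesis unfolding D_def s_def by simp
qed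

text \<open>One factor of the square is expanded over the points \<open>i\<close> of
  \<open>A\<close>. In the other factor the contribution of \<open>i\<close> itself gives the cubes,
  and the remaining points are controlled by \<open>link_bound\<close>.\<close>

lemma sum_weight_square_le:
  fixes S q D :: real
  assumes "finite V" "0 < k" "k \<le> card V" "F \<subseteq> nsets V k" "0 < \<mu>"
  defines "S \<equiv> real ((card V - 1) choose (k - 1))" and "q \<equiv> (real k - 1) / (real (card V) - 1)"
    and "D \<equiv> (\<Sum>i\<in>V. (real (deg F i))\<^sup>2)"
  shows "(\<Sum>A\<in>F. (\<Sum>i\<in>A. real (deg F i))\<^sup>2) \<le> (\<Sum>i\<in>V. real (deg F i) ^ 3) +
    D * (q * (k * card F) + \<mu> + k * card F * q * S / (4 * \<mu>))"
proof -
  let ?d = "\<lambda>i. real (deg F i)"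
  let ?W = "\<Sum>i\<in>V. ?d i"
  have "(\<Sum>A\<in>F. (\<Sum>i\<in>A. ?d i)\<^sup>2) = (\<Sum>A\<in>F. \<Sum>i\<in>A. ?d i * (\<Sum>j\<in>A. ?d j))"
    by (simp add: power2_eq_square sum_distrib_right)
  also have "\<dots> = (\<Sum>i\<in>V. ?d i * (\<Sum>A | A \<in> F \<and> i \<in> A. \<Sum>j\<in>A. ?d j))"
    using sum_members[OF assms(1,4)] by (simp add: sum_distrib_left)
  also have "\<dots> \<le> (\<Sum>i\<in>V. ?d i * (?d i * ?d i + (?d i * (q * ?W + \<mu>) + q * S * D / (4 * \<mu>))))"
  proof (intro sum_mono mult_left_mono)
    fix i assume i: "i \<in> V"
    have "(\<Sum>A | A \<in> F \<and> i \<in> A. \<Sum>j\<in>A. ?d j) =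
        (\<Sum>A | A \<in> F \<and> i \<in> A. ?d i + (\<Sum>j\<in>A - {i}. ?d j))"
      using assms(4) by (intro sum.cong) (auto simp: nsets_def sum.remove)
    also have "\<dots> = ?d i * ?d i + (\<Sum>A | A \<in> F \<and> i \<in> A. \<Sum>j\<in>A - {i}. ?d j)"
      by (simp add: sum.distrib deg_def)
    also have "(\<Sum>A | A \<in> F \<and> i \<in> A. \<Sum>j\<in>A - {i}. ?d j) \<le>
        ?d i * (q * ?W + \<mu>) + q * S * D / (4 * \<mu>)"
      using link_bound[OF assms(1-5) i, of ?d] unfolding S_def q_def D_def by simp
    finally show "(\<Sum>A | A \<in> F \<and> i \<in> A. \<Sum>j\<in>A. ?d j) \<le>
        ?d i * ?d i + (?d i * (q * ?W + \<mu>) + q * S * D / (4 * \<mu>))" by simp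
  qed simp
  also have "\<dots> = (\<Sum>i\<in>V. ?d i ^ 3 + (q * ?W + \<mu>) * (?d i)\<^sup>2 + (q * S * D / (4 * \<mu>)) * ?d i)"
    by (intro sum.cong) (simp_all add: power2_eq_square power3_eq_cube algebra_simps)
  also have "\<dots> = (\<Sum>i\<in>V. ?d i ^ 3) + (q * ?W + \<mu>) * D + q * S * D / (4 * \<mu>) * ?W"
    by (simp only: sum.distrib sum_distrib_left[symmetric] D_def)
  also have "\<dots> = (\<Sum>i\<in>V. ?d i ^ 3) + D * (q * ?W + \<mu> + ?W * q * S / (4 * \<mu>))"
    by (simp add: algebra_simps)
  finally show ?thesis unfolding sum_deg[OF assms(1,4)] by simp
qed

text \<open>Stars are nearly disjoint: a member through \<open>i\<close> that meets \<open>J\<close>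
  elsewhere contains one of fewer than \<open>card J\<close> pairs, each lying in
  \<open>q * S\<close> k-sets.\<close>

lemma deg_le_only:
  fixes S q :: real
  assumes "finite V" "0 < k" "F \<subseteq> nsets V k" "J \<subseteq> V" "i \<in> J"
  defines "S \<equiv> real ((card V - 1) choose (k - 1))" and "q \<equiv> (real k - 1) / (real (card V) - 1)"
  shows "real (deg F i) \<le> card {A \<in> F. A \<inter> J = {i}} + real (card J) * (q * S)"
proof -
  have finJ: "finite J" using assms(1,4) finite_subset by blast
  have finF: "finite F" using finite_family[OF assms(1,3)] .
  let ?C = "{A \<in> F. A \<inter> J = {i}}" and ?P = "\<lambda>j. {A \<in> nsets V k. i \<in> A \<and> j \<in> A}"
  have "{A \<in> F. i \<in> A} \<subseteq> ?C \<union> (\<Union>j\<in>J - {i}. ?P j)" using assms(3,5) by blast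
  then have "deg F i \<le> card (?C \<union> (\<Union>j\<in>J - {i}. ?P j))"
    unfolding deg_def using finF finJ assms(1) by (intro card_mono) auto
  also have "\<dots> \<le> card ?C + card (\<Union>j\<in>J - {i}. ?P j)" by (rule card_Un_le)
  also have "card (\<Union>j\<in>J - {i}. ?P j) \<le> (\<Sum>j\<in>J - {i}. card (?P j))"
    using finJ by (intro card_UN_le) simp
  finally have "real (deg F i) \<le> card ?C + (\<Sum>j\<in>J - {i}. real (card (?P j)))"
    by (simp flip: of_nat_sum of_nat_add)
  also have "(\<Sum>j\<in>J - {i}. real (card (?P j))) = (\<Sum>j\<in>J - {i}. q * S)"
  proof (rule sum.cong)
    fix j assume "j \<in> J - {i}"
    then show "real (card (?P j)) = q * S"
      using codegree[OF assms(1), of i j k] assms(2,4,5) unfolding q_def S_def by auto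
  qed simp
  also have "\<dots> = real (card J - 1) * (q * S)" using assms(5) finJ by simp
  also have "\<dots> \<le> real (card J) * (q * S)"
  proof (rule mult_right_mono)
    have "V \<noteq> {}" using assms(4,5) by auto
    then have "card V \<ge> 1" using assms(1) by (simp add: Suc_leI card_gt_0_iff)
    then show "0 \<le> q * S" using assms(2) by (simp add: q_def S_def)
  qed simp
  finally show ?thesis by simp
qed

lemma sum_deg_le_hit:
  fixes S q :: real
  assumes "finite V" "0 < k" "F \<subseteq> nsets V k" "J \<subseteq> V"
  defines "S \<equiv> real ((card V - 1) choose (k - 1))" and "q \<equiv> (real k - 1) / (real (card V) - 1)"
  shows "(\<Sum>i\<in>J. real (deg F i)) \<le> card {A \<in> F. A \<inter> J \<noteq> {}} + real (card J) ^ 2 * (q * S)"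
proof -
  have finJ: "finite J" using assms(1,4) finite_subset by blast
  have finF: "finite F" using finite_family[OF assms(1,3)] .
  let ?C = "\<lambda>i. {A \<in> F. A \<inter> J = {i}}"
  have "(\<Sum>i\<in>J. card (?C i)) = card (\<Union>i\<in>J. ?C i)"
    using finJ finF by (intro card_UN_disjoint[symmetric]) auto
  also have "\<dots> \<le> card {A \<in> F. A \<inter> J \<noteq> {}}" using finF by (intro card_mono) auto
  finally have "(\<Sum>i\<in>J. real (card (?C i))) \<le> card {A \<in> F. A \<inter> J \<noteq> {}}"
    by (simp flip: of_nat_sum)
  moreover have "(\<Sum>i\<in>J. real (deg F i)) \<le> (\<Sum>i\<in>J. card (?C i) + real (card J) * (q * S))"
    unfolding S_def q_def by (intro sum_mono deg_le_only[OF assms(1-4)])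
  ultimately show ?thesis by (simp add: sum.distrib power2_eq_square algebra_simps)
qed

text \<open>A member that meets both \<open>A\<close> and \<open>J\<close> contains one of the
  \<open>card J * k\<close> pairs with one point in \<open>J\<close> and the other in
  \<open>A\<close>.\<close>

lemma meet_le_if_missing:
  fixes S q :: real
  assumes "finite V" "0 < k" "F \<subseteq> nsets V k" "J \<subseteq> V" "A \<in> nsets V k" "A \<inter> J = {}"
  defines "S \<equiv> real ((card V - 1) choose (k - 1))" and "q \<equiv> (real k - 1) / (real (card V) - 1)"
  shows "real (meet F A) \<le> card {B \<in> F. B \<inter> J = {}} + real (card J) * k * (q * S)"
proof -
  have finJ: "finite J" using assms(1,4) finite_subset by blast
  have finF: "finite F" using finite_family[OF assms(1,3)] .
  have A: "A \<subseteq> V" "finite A" "card A = k" using assms(5) by (auto simp: nsets_def)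
  let ?P = "\<lambda>i j. {B \<in> nsets V k. i \<in> B \<and> j \<in> B}"
  have "{B \<in> F. A \<inter> B \<noteq> {}} \<subseteq> {B \<in> F. B \<inter> J = {}} \<union> (\<Union>i\<in>J. \<Union>j\<in>A. ?P i j)"
    using assms(3) by blast
  then have "meet F A \<le> card ({B \<in> F. B \<inter> J = {}} \<union> (\<Union>i\<in>J. \<Union>j\<in>A. ?P i j))"
    unfolding meet_def using finF finJ A(2) assms(1) by (intro card_mono) auto
  also have "\<dots> \<le> card {B \<in> F. B \<inter> J = {}} + card (\<Union>i\<in>J. \<Union>j\<in>A. ?P i j)" by (rule card_Un_le)
  also have "card (\<Union>i\<in>J. \<Union>j\<in>A. ?P i j) \<le> (\<Sum>i\<in>J. card (\<Union>j\<in>A. ?P i j))"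
    by (rule card_UN_le[OF finJ])
  also have "\<dots> \<le> (\<Sum>i\<in>J. \<Sum>j\<in>A. card (?P i j))"
    by (intro sum_mono card_UN_le A(2))
  finally have "real (meet F A) \<le> card {B \<in> F. B \<inter> J = {}} + (\<Sum>i\<in>J. \<Sum>j\<in>A. real (card (?P i j)))"
    by (simp flip: of_nat_sum of_nat_add)
  also have "(\<Sum>i\<in>J. \<Sum>j\<in>A. real (card (?P i j))) = (\<Sum>i\<in>J. \<Sum>j\<in>A. q * S)"
  proof (intro sum.cong refl)
    fix i j assume "i \<in> J" "j \<in> A"
    then have "i \<in> V" "j \<in> V" "i \<noteq> j" using A(1) assms(4,6) by auto
    then show "real (card (?P i j)) = q * S"
      using codegree[OF assms(1) _ _ _ assms(2)] unfolding q_def S_def by blast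
  qed
  finally show ?thesis using A by (simp add: mult.assoc)
qed

text \<open>Here \<open>d\<close> stands for the degrees and \<open>\<sigma>\<close> for the size of the family, both divided by the size
  of a star; \<open>m\<close> is the normalised number of intersecting pairs.\<close>
lemma heavy_elements:
  fixes d :: "nat \<Rightarrow> real"
  assumes "finite V" "\<And>i. i \<in> V \<Longrightarrow> 0 \<le> d i"
  defines "D \<equiv> (\<Sum>i\<in>V. (d i)\<^sup>2)"
  defines "J \<equiv> {i \<in> V. 1 / 2 \<le> d i}"
  assumes r: "2 \<le> (r::real)" and g: "0 \<le> \<gamma>" "\<gamma> \<le> 1" and s: "\<sigma> \<le> r - 1 + \<gamma>"
    and D2: "D \<le> 2 * \<sigma>"
    and cs: "D\<^sup>2 \<le> \<sigma> * ((\<Sum>i\<in>V. d i ^ 3) + D / (500 * r))"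
    and md: "\<And>i. i \<in> V \<Longrightarrow> \<sigma> * d i \<le> m" and mD: "m \<le> D"
    and low: "r - 1 + \<gamma>\<^sup>2 - 1 / 1000 \<le> m"
  shows "\<exists>i\<in>V. 3 / 4 \<le> d i" and "real (card J) \<le> 8 * r" and "\<sigma> - 1 / 10 \<le> (\<Sum>i\<in>J. d i)"
    and "(\<Sum>i\<in>J. d i) \<le> \<sigma> + 1 / 20 \<Longrightarrow> real (card J) < r + 1"
proof -
  \<comment> \<open>The point 3/8 minimises \<open>4 * \<gamma>\<^sup>2 - 3 * \<gamma>\<close>, the
    expression that decides whether \<open>M\<close> can be below 3/4.\<close>
  have g2: "0 \<le> (\<gamma> - 3/8)\<^sup>2" by simp
  have Dpos: "0 < D" using mD low r zero_le_power2[of \<gamma>] by linarith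
  have spos: "0 < \<sigma>" using Dpos D2 by linarith
  have V: "V \<noteq> {}" using Dpos by (auto simp: D_def)
  define M where "M = Max (d ` V)"
  have M: "d i \<le> M" if "i \<in> V" for i using assms(1) that by (simp add: M_def)
  obtain i0 where i0: "i0 \<in> V" "d i0 = M"
  proof -
    have "M \<in> d ` V" unfolding M_def using assms(1) V by (intro Max_in) auto
    then show ?thesis using that by blast
  qed
  have sMD: "\<sigma> * M \<le> D" using md[OF i0(1)] i0(2) mD by simp
  have r500: "D / (500 * r) \<le> 1 / 250"
  proof -
    have "D \<le> 2 * r" using D2 s g by linarith
    then show ?thesis using r by (simp add: field_simps)
  qed
  have T3: "(\<Sum>i\<in>V. d i ^ 3) \<le> M * D"
    unfolding D_def sum_distrib_left
  proof (rule sum_mono)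
    fix i assume "i \<in> V"
    then have "d i * (d i)\<^sup>2 \<le> M * (d i)\<^sup>2" using M by (intro mult_right_mono) auto
    then show "d i ^ 3 \<le> M * (d i)\<^sup>2" by (simp add: power3_eq_cube power2_eq_square mult.assoc)
  qed
  \<comment> \<open>The converse of \<open>sMD\<close> up to a small error: \<open>cs\<close> with
    all cubes bounded by means of the maximum \<open>M\<close>.\<close>
  have sM: "D \<le> \<sigma> * M + 1 / 250"
  proof -
    have "D * D \<le> \<sigma> * ((\<Sum>i\<in>V. d i ^ 3) + D / (500 * r))"
      using cs by (simp add: power2_eq_square)
    also have "\<dots> \<le> \<sigma> * (M * D + D / (500 * r))"
      using T3 spos by (intro mult_left_mono add_right_mono) auto
    also have "\<dots> = D * (\<sigma> * M + \<sigma> / (500 * r))" by (simp add: algebra_simps)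
    finally have "D \<le> \<sigma> * M + \<sigma> / (500 * r)" using Dpos by simp
    moreover have "\<sigma> / (500 * r) \<le> 1 / 250" using s g r by (simp add: field_simps)
    ultimately show ?thesis by simp
  qed
  have M34: "3 / 4 \<le> M"
  proof (rule ccontr)
    assume "\<not> 3 / 4 \<le> M"
    then have "\<sigma> * M \<le> \<sigma> * (3/4)" using spos by (intro mult_left_mono) auto
    then have "4 * (\<sigma> * M) \<le> 3 * \<sigma>" by simp
    then have "4 * (r - 1 + \<gamma>\<^sup>2 - 1 / 1000 - 1 / 250) \<le> 3 * (r - 1 + \<gamma>)"
      using sM mD low s by argo
    then show False using g2 r by (simp add: power2_eq_square algebra_simps)
  qed
  then show "\<exists>i\<in>V. 3 / 4 \<le> d i" using i0 by auto
  \<comment> \<open>Together, \<open>sMD\<close> and \<open>cs\<close> leave almost no room between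
    \<open>M * D\<close> and the sum of cubes, so the mass of \<open>D\<close> sits where
    \<open>d\<close> is close to \<open>M\<close>. Each of \<open>light\<close> and
    \<open>heavy\<close> reads this off on one side of the threshold 1/2.\<close>
  have gap: "(\<Sum>i\<in>V. (d i)\<^sup>2 * (M - d i)) \<le> 1 / 250"
  proof -
    have "\<sigma> * (M * D) \<le> D * D" using mult_right_mono[OF sMD, of D] Dpos by (simp add: algebra_simps)
    also have "\<dots> \<le> \<sigma> * ((\<Sum>i\<in>V. d i ^ 3) + D / (500 * r))" using cs by (simp add: power2_eq_square)
    finally have "M * D \<le> (\<Sum>i\<in>V. d i ^ 3) + D / (500 * r)" using spos by simp
    moreover have "(\<Sum>i\<in>V. (d i)\<^sup>2 * (M - d i)) = M * D - (\<Sum>i\<in>V. d i ^ 3)"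
      unfolding D_def by (simp add: sum_distrib_left sum_subtractf[symmetric] power2_eq_square
          power3_eq_cube algebra_simps)
    ultimately show ?thesis using r500 by linarith
  qed
  have J: "J \<subseteq> V" "finite J" using assms(1) by (auto simp: J_def)
  have DJ: "D = (\<Sum>i\<in>V - J. (d i)\<^sup>2) + (\<Sum>i\<in>J. (d i)\<^sup>2)"
    unfolding D_def using sum.subset_diff[OF J(1) assms(1)] .
  have gapJ: "(\<Sum>i\<in>V - J. (d i)\<^sup>2 * (M - d i)) + (\<Sum>i\<in>J. (d i)\<^sup>2 * (M - d i)) \<le> 1 / 250"
    using gap sum.subset_diff[OF J(1) assms(1), of "\<lambda>i. (d i)\<^sup>2 * (M - d i)"] by simp
  have pos: "0 \<le> (\<Sum>i\<in>V - J. (d i)\<^sup>2 * (M - d i))" "0 \<le> (\<Sum>i\<in>J. (d i)\<^sup>2 * (M - d i))"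
    using M J(1) by (auto intro!: sum_nonneg)
  have light: "(\<Sum>i\<in>V - J. (d i)\<^sup>2) \<le> 4 / 250"
  proof -
    have "(\<Sum>i\<in>V - J. (d i)\<^sup>2 * (1/4)) \<le> (\<Sum>i\<in>V - J. (d i)\<^sup>2 * (M - d i))"
      using M34 by (intro sum_mono mult_left_mono) (auto simp: J_def)
    then show ?thesis using gapJ pos by (simp add: sum_distrib_right[symmetric] flip: sum_divide_distrib)
  qed
  have quarter: "1 / 4 \<le> (d i)\<^sup>2" if "i \<in> J" for i
    using that power_mono[of "1/2" "d i" 2] by (simp add: J_def power2_eq_square)
  have heavy: "(\<Sum>i\<in>J. M - d i) \<le> 4 / 250"
  proof -
    have "(\<Sum>i\<in>J. (1/4) * (M - d i)) \<le> (\<Sum>i\<in>J. (d i)\<^sup>2 * (M - d i))"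
      using M J(1) quarter by (intro sum_mono mult_right_mono) auto
    then show ?thesis using gapJ pos unfolding sum_distrib_left[symmetric] by linarith
  qed
  show "real (card J) \<le> 8 * r"
  proof -
    have "(\<Sum>i\<in>J. 1 / 4) \<le> (\<Sum>i\<in>J. (d i)\<^sup>2)" by (intro sum_mono quarter)
    also have "\<dots> \<le> D" unfolding DJ by (simp add: sum_nonneg)
    finally show ?thesis using D2 s g by simp
  qed
  show "\<sigma> - 1 / 10 \<le> (\<Sum>i\<in>J. d i)"
  proof -
    have "(\<Sum>i\<in>J. (d i)\<^sup>2) \<le> (\<Sum>i\<in>J. M * d i)"
      unfolding power2_eq_square using M J(1) assms(2) by (intro sum_mono mult_right_mono) auto
    then have "\<sigma> * M - 4 / 250 \<le> M * (\<Sum>i\<in>J. d i)"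
      using sMD DJ light by (simp add: sum_distrib_left)
    then have "M * (\<sigma> - (\<Sum>i\<in>J. d i)) \<le> 4 / 250" by (simp add: algebra_simps)
    show ?thesis
    proof (rule ccontr)
      assume "\<not> ?thesis"
      then have "(3/4) * (1/10) \<le> M * (\<sigma> - (\<Sum>i\<in>J. d i))"
        using M34 by (intro mult_mono) auto
      then show False using \<open>M * (\<sigma> - (\<Sum>i\<in>J. d i)) \<le> 4 / 250\<close> by simp
    qed
  qed
  assume up: "(\<Sum>i\<in>J. d i) \<le> \<sigma> + 1 / 20"
  have JM: "card J * M \<le> \<sigma> + 7 / 100" using heavy up by (simp add: sum_subtractf)
  show "real (card J) < r + 1"
  proof (rule ccontr)
    assume "\<not> real (card J) < r + 1"
    then have "(r + 1) * M \<le> card J * M" using M34 by (intro mult_right_mono) auto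
    then have "(r + 1) * M \<le> \<sigma> + 7 / 100" using JM by linarith
    \<comment> \<open>Multiplying by \<sigma> produces \<open>\<sigma> * M\<close>, which
      \<open>sM\<close>, \<open>mD\<close> and \<open>low\<close> bound from below.\<close>
    then have "\<sigma> * ((r + 1) * M) \<le> \<sigma> * (\<sigma> + 7 / 100)" using spos by (intro mult_left_mono) auto
    also have "\<dots> \<le> (r - 1 + \<gamma>) * (r - 1 + \<gamma> + 7 / 100)" using s spos by (intro mult_mono) auto
    finally have *: "(r + 1) * (\<sigma> * M) \<le> (r - 1 + \<gamma>) * (r - 1 + \<gamma> + 7 / 100)"
      by (simp add: algebra_simps)
    have "(r + 1) * (r - 1 + \<gamma>\<^sup>2 - 1 / 200) \<le> (r + 1) * (\<sigma> * M)"
      using sM mD low r by (intro mult_left_mono) auto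
    with * have **: "(r + 1) * (r - 1 + \<gamma>\<^sup>2 - 1 / 200) \<le> (r - 1 + \<gamma>) * (r - 1 + \<gamma> + 7 / 100)" by linarith
    \<comment> \<open>The slack in Cauchy--Schwarz for \<open>r - 1\<close> ones and one entry
      \<gamma>. After it cancels the main terms, the surplus
      \<open>r - 1 + \<gamma>\<^sup>2\<close>, at least 1, would have to fit into the error
      terms.\<close>
    have "r * (r - 1 + \<gamma>\<^sup>2) - (r - 1 + \<gamma>)\<^sup>2 = (r - 1) * (1 - \<gamma>)\<^sup>2"
      by (simp add: power2_eq_square algebra_simps)
    moreover have "0 \<le> (r - 1) * (1 - \<gamma>)\<^sup>2" using r by simp
    ultimately have "(r - 1 + \<gamma>)\<^sup>2 \<le> r * (r - 1 + \<gamma>\<^sup>2)" by linarith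
    moreover have "(r + 1) * (r - 1 + \<gamma>\<^sup>2 - 1 / 200) = r * (r - 1 + \<gamma>\<^sup>2) + (r - 1 + \<gamma>\<^sup>2) - (r + 1) / 200"
      by (simp add: field_simps)
    moreover have "(r - 1 + \<gamma>) * (r - 1 + \<gamma> + 7 / 100) = (r - 1 + \<gamma>)\<^sup>2 + 7 / 100 * (r - 1 + \<gamma>)"
      by (simp add: power2_eq_square field_simps)
    ultimately have "r - 1 + \<gamma>\<^sup>2 \<le> (r + 1) / 200 + 7 / 100 * (r - 1 + \<gamma>)" using ** by linarith
    then show False using r g zero_le_power2[of \<gamma>] by argo
  qed
qed

section \<open>Extremal families without full stars\<close>

text \<open>Exchange \<open>A\<close> for a missing set \<open>B\<close> through \<open>i\<close>.
  By extremality \<open>B\<close> meets no more of the remaining members than \<open>A\<close> does,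
  yet \<open>B\<close> meets every remaining member of the star at \<open>i\<close>.\<close>

lemma deg_le_meet_if_extremal:
  assumes "finite V" "0 < k" "F \<subseteq> nsets V k"
    and extremal: "\<And>G. G \<subseteq> nsets V k \<Longrightarrow> card G = card F \<Longrightarrow> dp F \<le> dp G"
    and "\<not> hit V k {i} \<subseteq> F" "A \<in> F"
  shows "deg F i \<le> meet F A"
proof -
  obtain B where B: "B \<in> nsets V k" "i \<in> B" "B \<notin> F" using assms(5) by (auto simp: hit_def)
  define F0 where "F0 = F - {A}"
  have fin: "finite F" "finite F0" using finite_family[OF assms(1,3)] by (auto simp: F0_def)
  have F: "F = insert A F0" "A \<notin> F0" "B \<notin> F0" using assms(6) B by (auto simp: F0_def)
  have ne: "A \<noteq> {}" "B \<noteq> {}" using empty_notin_nsets[OF assms(3,2)] assms(6) B(2) by auto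
  have "dp F \<le> dp (insert B F0)"
  proof (rule extremal)
    show "insert B F0 \<subseteq> nsets V k" using assms(3) B(1) by (auto simp: F0_def)
    show "card (insert B F0) = card F"
      using card_insert_disjoint[OF fin(2) F(2)] card_insert_disjoint[OF fin(2) F(3)] F(1) by simp
  qed
  moreover have "dp F = dp F0 + dis F0 A" using dp_insert[OF fin(2) F(2) ne(1)] F(1) by simp
  moreover have "dp (insert B F0) = dp F0 + dis F0 B" using dp_insert[OF fin(2) F(3) ne(2)] .
  ultimately have "meet F0 B \<le> meet F0 A"
    using meet_plus_dis[OF fin(2), of A] meet_plus_dis[OF fin(2), of B] by linarith
  \<comment> \<open>\<open>A\<close> meets itself; this one compensates for \<open>A\<close>
    possibly belonging to the star at \<open>i\<close>.\<close>
  moreover have "meet F A = Suc (meet F0 A)"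
  proof -
    have "{X \<in> F. A \<inter> X \<noteq> {}} = insert A {X \<in> F0. A \<inter> X \<noteq> {}}" using ne(1) F(1) by auto
    then show ?thesis unfolding meet_def using F(2) fin(2) by simp
  qed
  moreover have "deg F i \<le> Suc (meet F0 B)"
  proof -
    have "{X \<in> F. i \<in> X} \<subseteq> insert A {X \<in> F0. B \<inter> X \<noteq> {}}" using B(2) F(1) by auto
    then have "deg F i \<le> card (insert A {X \<in> F0. B \<inter> X \<noteq> {}})"
      unfolding deg_def using fin(2) by (intro card_mono) auto
    also have "\<dots> \<le> Suc (card {X \<in> F0. B \<inter> X \<noteq> {}})" by (rule card_insert_le_m1) simp_all
    finally show ?thesis by (simp add: meet_def)
  qed
  ultimately show ?thesis by linarith
qed

text \<open>Members whose only point in \<open>R\<close> is \<open>i\<close> intersect each other,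
  and these classes are disjoint for different \<open>i\<close>.\<close>

lemma sum_meet_ge_only:
  assumes "finite V" "G \<subseteq> nsets V k" "finite R"
  shows "(\<Sum>i\<in>R. (card {A \<in> G. A \<inter> R = {i}})\<^sup>2) \<le> (\<Sum>A\<in>G. meet G A)"
proof -
  let ?C = "\<lambda>i. {A \<in> G. A \<inter> R = {i}}"
  have fin: "finite G" using finite_family[OF assms(1,2)] .
  have "(\<Sum>i\<in>R. (card (?C i))\<^sup>2) = (\<Sum>i\<in>R. \<Sum>A\<in>?C i. card (?C i))"
    by (simp add: power2_eq_square)
  also have "\<dots> \<le> (\<Sum>i\<in>R. \<Sum>A\<in>?C i. meet G A)"
    unfolding meet_def using fin by (intro sum_mono card_mono) auto
  also have "\<dots> = (\<Sum>A\<in>(\<Union>i\<in>R. ?C i). meet G A)"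
    using assms(3) fin by (intro sum.UNION_disjoint[symmetric]) auto
  also have "\<dots> \<le> (\<Sum>A\<in>G. meet G A)" using fin by (intro sum_mono2) auto
  finally show ?thesis .
qed

lemma card_hit_le:
  assumes "finite V" "P \<subseteq> V" "0 < k"
  shows "card (hit V k P) \<le> card P * ((card V - 1) choose (k - 1))"
proof -
  have finP: "finite P" using assms(1,2) finite_subset by blast
  have "hit V k P = (\<Union>i\<in>P. {A \<in> nsets V k. i \<in> A})" by (auto simp: hit_def)
  then have "card (hit V k P) \<le> (\<Sum>i\<in>P. card {A \<in> nsets V k. i \<in> A})"
    using card_UN_le[OF finP] by simp
  also have "\<dots> = (\<Sum>i\<in>P. (card V - 1) choose (k - 1))"
    using card_containing[OF assms(1) _ assms(3)] assms(2) by (intro sum.cong) auto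
  finally show ?thesis by simp
qed

text \<open>For families of equal size, fewer disjoint pairs means a larger sum of
  \<open>meet\<close>, so the sum for \<open>F\<close> is at least that of the comparison family.
  There \<open>sum_meet_ge_only\<close> applies, with all classes of size \<open>S'\<close> except
  one of size \<open>S' - h\<close>.\<close>

lemma extremal_sum_meet:
  fixes S :: real
  assumes "finite V" "0 < k" "R \<subseteq> V" "R \<noteq> {}" "F \<subseteq> nsets V k"
    and extremal: "\<And>G. G \<subseteq> nsets V k \<Longrightarrow> card G = card F \<Longrightarrow> dp F \<le> dp G"
    and "h \<le> (card V - card R) choose (k - 1)" "card F + h = card (hit V k R)"
  defines "S' \<equiv> real ((card V - card R) choose (k - 1))"
  shows "(real (card R) - 1) * S'\<^sup>2 + (S' - h)\<^sup>2 \<le> (\<Sum>A\<in>F. real (meet F A))"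
    and "real (card F) \<le> (real (card R) - 1) * real ((card V - 1) choose (k - 1)) + (S' - h)"
proof -
  obtain v where v: "v \<in> R" using assms(4) by blast
  have finR: "finite R" using assms(1,3) finite_subset by blast
  have cR: "card R = Suc (card (R - {v}))" using card_Suc_Diff1[OF finR v] by simp
  obtain H where H: "H \<subseteq> {A \<in> nsets V k. A \<inter> R = {v}}" "card H = h"
      "card (hit V k R - H) + h = card (hit V k R)"
    using lex_like_exists[OF assms(1-3) v assms(7)] .
  let ?G = "hit V k R - H"
  let ?C = "\<lambda>i. {A \<in> ?G. A \<inter> R = {i}}"
  have cG: "card ?G = card F" using H(3) assms(8) by linarith
  have GV: "?G \<subseteq> nsets V k" by (auto simp: hit_def)
  have finG: "finite ?G" "finite H" using assms(1) finite_subset[OF H(1)] by simp_all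
  have only: "card {A \<in> nsets V k. A \<inter> R = {i}} = (card V - card R) choose (k - 1)" if "i \<in> R" for i
    using card_meet_only[OF assms(1,3) that assms(2)] .
  have Cv: "real (card (?C v)) = S' - h"
  proof -
    have "?C v = {A \<in> nsets V k. A \<inter> R = {v}} - H" by (auto simp: hit_def)
    then have "card (?C v) = ((card V - card R) choose (k - 1)) - h"
      using card_Diff_subset[OF finG(2) H(1)] only[OF v] H(2) by simp
    then show ?thesis using assms(7) by (simp add: S'_def of_nat_diff)
  qed
  have Ci: "real (card (?C i)) = S'" if "i \<in> R - {v}" for i
  proof -
    have "?C i = {A \<in> nsets V k. A \<inter> R = {i}}" using H(1) that by (auto simp: hit_def)
    then show ?thesis using only[of i] that by (simp add: S'_def)
  qed
  have "(real (card R) - 1) * S'\<^sup>2 + (S' - h)\<^sup>2 = (\<Sum>i\<in>R - {v}. S'\<^sup>2) + (S' - h)\<^sup>2"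
    unfolding cR by simp
  also have "\<dots> = (\<Sum>i\<in>R. (real (card (?C i)))\<^sup>2)"
    using sum.remove[OF finR v, of "\<lambda>i. (real (card (?C i)))\<^sup>2"] Ci Cv by simp
  also have "\<dots> = real (\<Sum>i\<in>R. (card (?C i))\<^sup>2)" by simp
  also have "\<dots> \<le> real (\<Sum>A\<in>?G. meet ?G A)"
    using sum_meet_ge_only[OF assms(1) GV finR] by (simp only: of_nat_le_iff)
  also have "(\<Sum>A\<in>?G. meet ?G A) \<le> (\<Sum>A\<in>F. meet F A)"
  proof -
    have "(\<Sum>A\<in>?G. meet ?G A) + 2 * dp ?G = card F * card F"
      using sum_meet_plus_dp[OF finG(1) empty_notin_nsets[OF GV assms(2)]] cG by simp
    moreover have "(\<Sum>A\<in>F. meet F A) + 2 * dp F = card F * card F"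
      using sum_meet_plus_dp[OF finite_family[OF assms(1,5)] empty_notin_nsets[OF assms(5,2)]] .
    ultimately show ?thesis using extremal[OF GV cG] by linarith
  qed
  finally show "(real (card R) - 1) * S'\<^sup>2 + (S' - h)\<^sup>2 \<le> (\<Sum>A\<in>F. real (meet F A))" by simp
  have "insert v (R - {v}) = R" using v by auto
  then have "card F + h = card (hit V k (R - {v})) + ((card V - card R) choose (k - 1))"
    using card_hit_insert[OF assms(1), of "R - {v}" v k] assms(2,3,8) v by auto
  also have "card (hit V k (R - {v})) \<le> card (R - {v}) * ((card V - 1) choose (k - 1))"
    using card_hit_le[OF assms(1), of "R - {v}" k] assms(2,3) by auto
  finally have "real (card F + h) \<le> real (card (R - {v}) * ((card V - 1) choose (k - 1)) +
      ((card V - card R) choose (k - 1)))"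
    by (simp only: of_nat_le_iff)
  then show "real (card F) \<le> (real (card R) - 1) * real ((card V - 1) choose (k - 1)) + (S' - h)"
    unfolding cR S'_def by simp
qed

text \<open>Cauchy--Schwarz, from the nonnegativity of the squared deviations from the mean.\<close>

lemma square_sum_le_card_mult:
  fixes f :: "'a \<Rightarrow> real"
  assumes "finite X"
  shows "(\<Sum>x\<in>X. f x)\<^sup>2 \<le> card X * (\<Sum>x\<in>X. (f x)\<^sup>2)"
proof (cases "X = {}")
  case False
  define T where "T = (\<Sum>x\<in>X. f x)"
  define c where "c = real (card X)"
  have c: "0 < c" using False assms by (simp add: c_def card_gt_0_iff)
  have "0 \<le> (\<Sum>x\<in>X. (c * f x - T)\<^sup>2)" by (simp add: sum_nonneg)
  also have "\<dots> = (\<Sum>x\<in>X. c\<^sup>2 * (f x)\<^sup>2 - 2 * c * T * f x + T\<^sup>2)"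
    by (intro sum.cong) (auto simp: power2_eq_square algebra_simps)
  also have "\<dots> = c\<^sup>2 * (\<Sum>x\<in>X. (f x)\<^sup>2) - 2 * c * T * T + c * T\<^sup>2"
    by (simp add: sum.distrib sum_subtractf sum_distrib_left[symmetric] c_def T_def)
  also have "\<dots> = c * (c * (\<Sum>x\<in>X. (f x)\<^sup>2) - T\<^sup>2)"
    by (simp add: power2_eq_square algebra_simps)
  finally show ?thesis using c unfolding T_def c_def by (simp add: zero_le_mult_iff)
qed simp

text \<open>Everything is divided by the star size \<open>S\<close> and handed to
  \<open>heavy_elements\<close>. The points of normalised degree at least 1/2 then cover
  \<open>F\<close>, and there are at most \<open>r\<close> of them.\<close>

lemma extremal_covered:
  assumes "finite V" "0 < k" "2 \<le> r" and large: "10 ^ 6 * real k ^ 2 * real r ^ 3 \<le> real (card V)"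
    and "F \<subseteq> nsets V k"
    and extremal: "\<And>G. G \<subseteq> nsets V k \<Longrightarrow> card G = card F \<Longrightarrow> dp F \<le> dp G"
    and "h \<le> (card V - r) choose (k - 1)" "card F + h + ((card V - r) choose k) = card V choose k"
    and no_star: "\<And>i. i \<in> V \<Longrightarrow> \<not> hit V k {i} \<subseteq> F"
  obtains R where "R \<subseteq> V" "card R = r" "F \<subseteq> hit V k R"
proof -
  define n where "n = real (card V)"
  define K where "K = real k"
  define rr where "rr = real r"
  define S where "S = real ((card V - 1) choose (k - 1))"
  define S' where "S' = real ((card V - r) choose (k - 1))"
  define q where "q = (real k - 1) / (real (card V) - 1)"
  define s where "s = real (card F)"
  \<comment> \<open>The fraction of the last, incomplete star that the comparison family
    contains.\<close>
  define \<gamma> where "\<gamma> = (S' - h) / S"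
  define d where "d i = real (deg F i) / S" for i
  define D where "D = (\<Sum>i\<in>V. (real (deg F i))\<^sup>2)"
  define m where "m = (\<Sum>A\<in>F. real (meet F A)) / S\<^sup>2"
  have K1: "1 \<le> K" and r2: "2 \<le> rr" using assms(2,3) by (auto simp: K_def rr_def)
  have rr1: "1 \<le> rr ^ 2" "1 \<le> rr ^ 3" "1 \<le> K ^ 2"
    using K1 r2 by (auto intro: one_le_power)
  have nbig: "1000000 * (K\<^sup>2 * rr ^ 3) \<le> n" using large by (simp add: n_def K_def rr_def mult.assoc)
  have "K \<le> K\<^sup>2" "rr \<le> rr ^ 3" using K1 r2 by (auto intro: self_le_power)
  then have "K * 1 \<le> K\<^sup>2 * rr ^ 3" "1 * rr \<le> K\<^sup>2 * rr ^ 3"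
    using K1 r2 rr1 mult_mono[of K "K\<^sup>2" 1 "rr ^ 3"] mult_mono[of 1 "K\<^sup>2" rr "rr ^ 3"] by auto
  then have "K + rr \<le> n" using nbig K1 r2 by linarith
  then have kr: "k + r \<le> card V" unfolding n_def K_def rr_def by linarith
  have kV: "k \<le> card V" using kr by simp
  have n2: "2 \<le> n" using \<open>K + rr \<le> n\<close> K1 r2 by linarith
  have Spos: "0 < S" using kr assms(2) by (simp add: S_def)
  have finF: "finite F" using finite_family assms(1,5) .
  have q0: "0 \<le> q" using K1 n2 by (simp add: q_def n_def K_def)
  have qn: "q \<le> K / n"
    using n2 K1 kV unfolding q_def n_def K_def by (simp add: field_simps)
  \<comment> \<open>The lower bound on \<open>card V\<close> enters the error estimates in this
    form, as a bound on \<open>q\<close>.\<close>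
  have Kq: "K * rr ^ 3 * q \<le> 1 / 1000000"
  proof -
    have "K * rr ^ 3 * q \<le> K * rr ^ 3 * (K / n)" using qn K1 r2 by (intro mult_left_mono) auto
    also have "\<dots> \<le> 1 / 1000000" using nbig n2 by (simp add: field_simps power2_eq_square)
    finally show ?thesis .
  qed
  have small: "K * rr * q \<le> 1 / (1000000 * rr\<^sup>2)"
    using Kq r2 by (simp add: field_simps power2_eq_square power3_eq_cube)
  have small2: "rr\<^sup>2 * q \<le> 1 / 1000000"
  proof -
    have "1 * rr\<^sup>2 \<le> (K * rr) * rr\<^sup>2" using mult_mono[of 1 K 1 rr] K1 r2 by (intro mult_right_mono) auto
    then have "rr\<^sup>2 \<le> K * rr ^ 3" by (simp add: power2_eq_square power3_eq_cube mult.assoc)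
    then have "rr\<^sup>2 * q \<le> K * rr ^ 3 * q" using q0 by (rule mult_right_mono)
    then show ?thesis using Kq by linarith
  qed
  have small1: "K * rr * q \<le> 1 / 1000000"
  proof -
    have "1 / (1000000 * rr\<^sup>2) \<le> 1 / 1000000"
      using rr1 r2 by (intro divide_left_mono) auto
    then show ?thesis using small by linarith
  qed
  obtain R0 where R0: "R0 \<subseteq> V" "card R0 = r" "finite R0"
    using obtain_subset_with_card_n[of r V] kr by auto
  have R0ne: "R0 \<noteq> {}" using R0(2) assms(3) by auto
  have cF: "card F + h = card (hit V k R0)"
    using card_hit[OF assms(1) R0(1), of k] assms(8) unfolding R0(2) by linarith
  have hR: "h \<le> (card V - card R0) choose (k - 1)" using assms(7) R0(2) by simp
  note ext = extremal_sum_meet[OF assms(1,2) R0(1) R0ne assms(5) extremal hR cF,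
      unfolded R0(2), folded S'_def S_def rr_def s_def]
  have hS': "real h \<le> S'" using assms(7) by (simp add: S'_def)
  have S'S: "S' \<le> S" unfolding S'_def S_def using assms(3) by (intro of_nat_mono binomial_right_mono) simp
  \<comment> \<open>\<open>deg_le_only\<close> for the family of all k-sets.\<close>
  have SS': "S \<le> S' + rr * (q * S)"
  proof -
    obtain v where v: "v \<in> R0" using R0ne by blast
    have "real (deg (nsets V k) v) \<le> card {A \<in> nsets V k. A \<inter> R0 = {v}} + rr * (q * S)"
      using deg_le_only[OF assms(1,2) order_refl R0(1) v] R0(2) unfolding q_def S_def rr_def by simp
    moreover have "real (deg (nsets V k) v) = S"
      using card_containing[of V v k] assms(1,2) R0(1) v by (auto simp: deg_def S_def)
    moreover have "card {A \<in> nsets V k. A \<inter> R0 = {v}} = S'"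
      using card_meet_only[OF assms(1) R0(1) v assms(2)] R0(2) by (simp add: S'_def)
    ultimately show ?thesis by simp
  qed
  have g: "0 \<le> \<gamma>" "\<gamma> \<le> 1" using hS' S'S Spos by (auto simp: \<gamma>_def)
  have sS: "s / S \<le> rr - 1 + \<gamma>"
    using ext(2) Spos by (simp add: \<gamma>_def field_simps)
  have sr: "s \<le> rr * S"
  proof -
    have "s / S \<le> rr" using sS g by linarith
    then show ?thesis using Spos by (simp add: field_simps)
  qed
  have s0: "0 \<le> s" by (simp add: s_def)
  have low: "rr - 1 + \<gamma>\<^sup>2 - 1 / 1000 \<le> m"
  proof -
    have "1 - rr * q \<le> S' / S" using SS' Spos by (simp add: field_simps)
    moreover have "rr * q \<le> 1"
    proof -
      have "rr * q \<le> rr\<^sup>2 * q" using q0 r2 by (intro mult_right_mono) (auto simp: power2_eq_square)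
      then show ?thesis using small2 by simp
    qed
    ultimately have "(1 - rr * q)\<^sup>2 \<le> (S' / S)\<^sup>2" by (intro power_mono) auto
    moreover have "1 - 2 * (rr * q) \<le> (1 - rr * q)\<^sup>2" by (simp add: power2_diff)
    ultimately have "(rr - 1) * (1 - 2 * (rr * q)) \<le> (rr - 1) * (S' / S)\<^sup>2"
      using r2 by (intro mult_left_mono) auto
    moreover have "(rr - 1) * (1 - 2 * (rr * q)) = rr - 1 - 2 * (rr\<^sup>2 * q) + 2 * (rr * q)"
      by (simp add: power2_eq_square algebra_simps)
    moreover have "0 \<le> rr * q" using q0 r2 by simp
    moreover have "(rr - 1) * (S' / S)\<^sup>2 + \<gamma>\<^sup>2 \<le> m"
    proof -
      have "(rr - 1) * (S' / S)\<^sup>2 + \<gamma>\<^sup>2 = ((rr - 1) * S'\<^sup>2 + (S' - h)\<^sup>2) / S\<^sup>2"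
        by (simp add: \<gamma>_def power_divide add_divide_distrib)
      also have "\<dots> \<le> m" unfolding m_def using ext(1) by (intro divide_right_mono) auto
      finally show ?thesis .
    qed
    ultimately show ?thesis using small2 by linarith
  qed
  have D2: "D \<le> 2 * s * S"
  proof -
    have "2 * K\<^sup>2 * s \<le> 2 * K\<^sup>2 * (rr * S)" using sr by (intro mult_left_mono) auto
    also have "\<dots> = S * (2 * K\<^sup>2 * rr)" by simp
    also have "2 * K\<^sup>2 * rr \<le> n"
    proof -
      have "K\<^sup>2 * rr \<le> K\<^sup>2 * rr ^ 3" using \<open>rr \<le> rr ^ 3\<close> by (intro mult_left_mono) auto
      moreover have "0 \<le> K\<^sup>2 * rr" using r2 by simp
      ultimately show ?thesis using nbig by linarith
    qed
    finally have "2 * K\<^sup>2 * s \<le> S * n" using Spos by simp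
    then show ?thesis
      using sum_deg_square_le[OF assms(1,2) kV assms(5)] unfolding D_def s_def S_def K_def n_def by simp
  qed
  have Dg: "D = (\<Sum>A\<in>F. \<Sum>i\<in>A. real (deg F i))"
    using sum_members_deg[OF assms(1,5), of "\<lambda>i. real (deg F i)"] by (simp add: D_def power2_eq_square)
  have cs: "D\<^sup>2 \<le> s * ((\<Sum>i\<in>V. real (deg F i) ^ 3) + D * (S / (500 * rr)))"
  proof -
    \<comment> \<open>This balances the two error terms containing \<mu>, each at most
      \<open>S / (2000 * rr)\<close>. The cube of \<open>r\<close> in \<open>large\<close> is what
      makes the second one that small.\<close>
    define \<mu> where "\<mu> = S / (2000 * rr)"
    have \<mu>: "0 < \<mu>" using Spos r2 by (simp add: \<mu>_def)
    have D0: "0 \<le> D" by (simp add: D_def sum_nonneg)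
    have y: "q * (K * s) \<le> S / (1000000 * rr\<^sup>2)"
    proof -
      have "q * (K * s) \<le> q * (K * (rr * S))" using sr q0 K1 by (intro mult_left_mono) auto
      also have "\<dots> = (K * rr * q) * S" by simp
      also have "\<dots> \<le> 1 / (1000000 * rr\<^sup>2) * S" using small Spos by (intro mult_right_mono) auto
      finally show ?thesis by simp
    qed
    have "K * s * q * S / (4 * \<mu>) = q * (K * s) * (500 * rr)"
      using Spos r2 by (simp add: \<mu>_def field_simps)
    also have "\<dots> \<le> S / (1000000 * rr\<^sup>2) * (500 * rr)" using y r2 by (intro mult_right_mono) auto
    also have "\<dots> = S / (2000 * rr)" using r2 by (simp add: field_simps power2_eq_square)
    finally have e1: "K * s * q * S / (4 * \<mu>) \<le> S / (2000 * rr)" .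
    have "S / (1000000 * rr\<^sup>2) \<le> S / (1000 * rr)"
      using Spos r2 by (intro divide_left_mono) (auto simp: power2_eq_square)
    then have "q * (K * s) + \<mu> + K * s * q * S / (4 * \<mu>) \<le> S / (1000 * rr) + S / (2000 * rr) + S / (2000 * rr)"
      using y e1 unfolding \<mu>_def by linarith
    also have "\<dots> = S / (500 * rr)" using r2 by (simp add: field_simps)
    finally have e: "q * (K * s) + \<mu> + K * s * q * S / (4 * \<mu>) \<le> S / (500 * rr)" .
    have "(\<Sum>A\<in>F. (\<Sum>i\<in>A. real (deg F i))\<^sup>2) \<le> (\<Sum>i\<in>V. real (deg F i) ^ 3) +
        D * (q * (K * s) + \<mu> + K * s * q * S / (4 * \<mu>))"
      using sum_weight_square_le[OF assms(1,2) kV assms(5) \<mu>]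
      unfolding D_def q_def K_def s_def S_def by simp
    also have "\<dots> \<le> (\<Sum>i\<in>V. real (deg F i) ^ 3) + D * (S / (500 * rr))"
      using e D0 by (intro add_left_mono mult_left_mono)
    finally have "s * (\<Sum>A\<in>F. (\<Sum>i\<in>A. real (deg F i))\<^sup>2) \<le>
        s * ((\<Sum>i\<in>V. real (deg F i) ^ 3) + D * (S / (500 * rr)))"
      using s0 by (rule mult_left_mono)
    moreover have "D\<^sup>2 \<le> s * (\<Sum>A\<in>F. (\<Sum>i\<in>A. real (deg F i))\<^sup>2)"
      unfolding Dg s_def by (rule square_sum_le_card_mult[OF finF])
    ultimately show ?thesis by linarith
  qed
  have meet_ge: "real (deg F i) \<le> real (meet F A)" if "i \<in> V" "A \<in> F" for i A
    using deg_le_meet_if_extremal[OF assms(1,2,5) extremal no_star[OF that(1)] that(2)] by simp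
  define J where "J = {i \<in> V. 1 / 2 \<le> d i}"
  have dD: "(\<Sum>i\<in>V. (d i)\<^sup>2) = D / S\<^sup>2"
    by (simp add: d_def D_def power_divide sum_divide_distrib)
  have d3: "(\<Sum>i\<in>V. d i ^ 3) = (\<Sum>i\<in>V. real (deg F i) ^ 3) / S ^ 3"
    by (simp add: d_def power_divide sum_divide_distrib)
  have p1: "0 \<le> d i" for i using Spos by (simp add: d_def)
  have p2: "(\<Sum>i\<in>V. (d i)\<^sup>2) \<le> 2 * (s / S)"
    unfolding dD using D2 Spos by (simp add: field_simps power2_eq_square)
  have p3: "(\<Sum>i\<in>V. (d i)\<^sup>2)\<^sup>2 \<le> s / S * ((\<Sum>i\<in>V. d i ^ 3) + (\<Sum>i\<in>V. (d i)\<^sup>2) / (500 * rr))"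
  proof -
    have "D\<^sup>2 / S ^ 4 \<le> s * ((\<Sum>i\<in>V. real (deg F i) ^ 3) + D * (S / (500 * rr))) / S ^ 4"
      using cs by (rule divide_right_mono) simp
    also have "\<dots> = s / S * ((\<Sum>i\<in>V. real (deg F i) ^ 3) / S ^ 3 + D / S\<^sup>2 / (500 * rr))"
      using Spos r2 by (simp add: field_simps power2_eq_square power3_eq_cube power4_eq_xxxx)
    finally show ?thesis unfolding dD d3 by (simp add: power_divide)
  qed
  have p4: "s / S * d i \<le> m" if "i \<in> V" for i
  proof -
    have "s * real (deg F i) = (\<Sum>A\<in>F. real (deg F i))" by (simp add: s_def)
    also have "\<dots> \<le> (\<Sum>A\<in>F. real (meet F A))" using meet_ge[OF that] by (rule sum_mono)
    finally have "s * real (deg F i) / S\<^sup>2 \<le> m" unfolding m_def by (rule divide_right_mono) simp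
    then show ?thesis by (simp add: d_def power2_eq_square)
  qed
  have p5: "m \<le> (\<Sum>i\<in>V. (d i)\<^sup>2)"
  proof -
    have "(\<Sum>A\<in>F. real (meet F A)) \<le> D"
      unfolding Dg
    proof (rule sum_mono)
      fix A assume "A \<in> F"
      then have "finite A" using assms(5) by (auto simp: nsets_def)
      then show "real (meet F A) \<le> (\<Sum>i\<in>A. real (deg F i))"
        using meet_le_sum_deg[OF finF, of A] by (simp flip: of_nat_sum)
    qed
    then show ?thesis unfolding dD m_def by (rule divide_right_mono) simp
  qed
  note heavy = heavy_elements[OF assms(1) p1 r2 g sS p2 p3 p4 p5 low, folded J_def]
  have J: "J \<subseteq> V" by (auto simp: J_def)
  define F0 where "F0 = {A \<in> F. A \<inter> J = {}}"
  define j where "j = real (card J)"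
  have j: "0 \<le> j" "j \<le> 8 * rr" using heavy(2) by (auto simp: j_def)
  have split: "real (card {A \<in> F. A \<inter> J \<noteq> {}}) + real (card F0) = s"
  proof -
    have "F = {A \<in> F. A \<inter> J \<noteq> {}} \<union> F0" by (auto simp: F0_def)
    moreover have "card ({A \<in> F. A \<inter> J \<noteq> {}} \<union> F0) = card {A \<in> F. A \<inter> J \<noteq> {}} + card F0"
      using finF by (intro card_Un_disjoint) (auto simp: F0_def)
    ultimately show ?thesis by (simp add: s_def)
  qed
  \<comment> \<open>The stars at \<open>J\<close> overlap little, so their sizes and the members
    avoiding \<open>J\<close> nearly add up to at most \<open>card F\<close>.\<close>
  have Jd: "(\<Sum>i\<in>J. d i) + card F0 / S \<le> s / S + 1 / 1000"
  proof -
    have "j\<^sup>2 * q \<le> (8 * rr)\<^sup>2 * q" using j q0 by (intro mult_right_mono power_mono) auto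
    also have "\<dots> = 64 * (rr\<^sup>2 * q)" by (simp add: power_mult_distrib)
    finally have jq: "j\<^sup>2 * q \<le> 1 / 1000" using small2 by linarith
    have "(\<Sum>i\<in>J. real (deg F i)) + card F0 \<le> s + j\<^sup>2 * (q * S)"
      using sum_deg_le_hit[OF assms(1,2,5) J] split unfolding q_def S_def j_def by linarith
    then have "((\<Sum>i\<in>J. real (deg F i)) + card F0) / S \<le> (s + j\<^sup>2 * (q * S)) / S"
      using Spos by (intro divide_right_mono) auto
    also have "\<dots> = s / S + j\<^sup>2 * q" using Spos by (simp add: field_simps)
    finally show ?thesis using jq by (simp add: d_def sum_divide_distrib add_divide_distrib)
  qed
  have F0: "card F0 \<le> S / 4"
  proof -
    have "card F0 / S \<le> 1 / 4" using Jd heavy(3) by linarith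
    then show ?thesis using Spos by (simp add: field_simps)
  qed
  \<comment> \<open>A member avoiding \<open>J\<close> would meet at most \<open>S / 4\<close>
    members that avoid \<open>J\<close> and at most \<open>S / 4\<close> others, but the exchange
    argument at a point of normalised degree 3/4 demands \<open>3 / 4 * S\<close>.\<close>
  have "F0 = {}"
  proof (rule ccontr)
    assume "F0 \<noteq> {}"
    then obtain A where A: "A \<in> F" "A \<inter> J = {}" by (auto simp: F0_def)
    have AV: "A \<in> nsets V k" using A(1) assms(5) by blast
    obtain i where i: "i \<in> V" "3 / 4 \<le> d i" using heavy(1) by blast
    have "j * (K * q) \<le> 8 * rr * (K * q)" using j(2) K1 q0 by (intro mult_right_mono) auto
    also have "\<dots> = 8 * (K * rr * q)" by simp
    finally have "j * (K * q) \<le> 1 / 4" using small1 by linarith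
    then have "j * (K * q) * S \<le> 1 / 4 * S" using Spos by (intro mult_right_mono) auto
    moreover have "real (meet F A) \<le> card F0 + j * K * (q * S)"
      using meet_le_if_missing[OF assms(1,2,5) J AV A(2)] unfolding F0_def j_def K_def q_def S_def .
    moreover have "j * K * (q * S) = j * (K * q) * S" by simp
    moreover have "3 / 4 * S \<le> deg F i" using i(2) Spos by (simp add: d_def field_simps)
    ultimately show False using meet_ge[OF i(1) A(1)] F0 Spos by linarith
  qed
  then have cover: "A \<inter> J \<noteq> {}" if "A \<in> F" for A using that by (auto simp: F0_def)
  have "(\<Sum>i\<in>J. d i) \<le> s / S + 1 / 20"
  proof -
    have "0 \<le> card F0 / S" using Spos by simp
    then show ?thesis using Jd by linarith
  qed
  then have "real (card J) < rr + 1" using heavy(4) by blast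
  then have "card J \<le> r" unfolding rr_def by linarith
  \<comment> \<open>\<open>J\<close> may be smaller than \<open>r\<close> and is padded to exactly
    \<open>r\<close> points.\<close>
  then obtain R where R: "J \<subseteq> R" "R \<subseteq> V" "card R = r"
    using exists_subset_between[of J r V] J assms(1) kr by auto
  have "F \<subseteq> hit V k R" using assms(5) cover R(1) by (fastforce simp: hit_def)
  then show ?thesis using that R by blast
qed

section \<open>Comparison with the lexicographic family\<close>

text \<open>A family minimising \<open>dp\<close> at the given size either contains a full star,
  whose deletion leads to \<open>r - 1\<close> with the same \<open>h\<close>, or is covered by
  \<open>r\<close> points and compared by \<open>dp_ge_if_covered\<close>.\<close>

lemma lex_value_le_dp:
  assumes "finite V" "0 < k" "0 < r" "10 ^ 6 * real k ^ 2 * real r ^ 3 \<le> real (card V)"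
    "F \<subseteq> nsets V k" "h \<le> (card V - r) choose (k - 1)"
    "card F + h + ((card V - r) choose k) = card V choose k"
  shows "lex_value k r (card V) h \<le> dp F"
  using assms
proof (induction r arbitrary: V F)
  case 0
  then show ?case by simp
next
  case (Suc r)
  show ?case
  proof (cases "r = 0")
    case True
    then show ?thesis by simp
  next
    case False
    obtain G where G: "G \<subseteq> nsets V k" "card G = card F"
      and min: "\<And>H. H \<subseteq> nsets V k \<Longrightarrow> card H = card F \<Longrightarrow> dp G \<le> dp H"
      using ex_has_least_nat[of "\<lambda>G. G \<subseteq> nsets V k \<and> card G = card F" F dp] Suc.prems(5) by blast
    have cG: "card G + h + ((card V - Suc r) choose k) = card V choose k"
      using Suc.prems(7) G(2) by simp
    have "lex_value k (Suc r) (card V) h \<le> dp G"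
    proof (cases "\<exists>w\<in>V. hit V k {w} \<subseteq> G")
      case True
      then obtain w where w: "w \<in> V" "hit V k {w} \<subseteq> G" by blast
      let ?G = "{A \<in> G. w \<notin> A}" and ?W = "V - {w}"
      note split = full_star_split[OF Suc.prems(1) G(1) Suc.prems(2) w]
      have "V \<noteq> {}" using w(1) by blast
      then have V1: "1 \<le> card V" using Suc.prems(1) by (simp add: Suc_leI card_gt_0_iff)
      have cW: "card ?W = card V - 1" using w(1) by simp
      have pascal: "card V choose k = ((card V - 1) choose (k - 1)) + ((card V - 1) choose k)"
        using V1 Suc.prems(2) by (intro choose_reduce_nat) auto
      have cG': "card ?G + h + ((card V - 1 - r) choose k) = (card V - 1) choose k"
        using split(2) cG pascal by simp
      have "lex_value k r (card ?W) h \<le> dp ?G"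
      proof (rule Suc.IH)
        \<comment> \<open>Deleting a point lowers \<open>card V\<close> by 1, while passing from
          \<open>Suc r\<close> to \<open>r\<close> lowers the required size by at least
          \<open>10 ^ 6 * real k ^ 2\<close>.\<close>
        have "10 ^ 6 * real k ^ 2 * 1 \<le> 10 ^ 6 * real k ^ 2 * (real (Suc r) ^ 3 - real r ^ 3)"
        proof (rule mult_left_mono)
          have "real (Suc r) ^ 3 - real r ^ 3 = 1 + 3 * real r + 3 * (real r)\<^sup>2"
            by (simp add: power2_eq_square power3_eq_cube algebra_simps)
          then show "1 \<le> real (Suc r) ^ 3 - real r ^ 3" by simp
        qed simp
        moreover have "1 \<le> real k ^ 2" using Suc.prems(2) by (simp add: one_le_power)
        ultimately show "10 ^ 6 * real k ^ 2 * real r ^ 3 \<le> real (card ?W)"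
          using Suc.prems(4) V1 unfolding cW by (simp add: of_nat_diff right_diff_distrib)
        show "h \<le> (card ?W - r) choose (k - 1)" using Suc.prems(6) cW by simp
        show "card ?G + h + ((card ?W - r) choose k) = card ?W choose k"
          using cG' unfolding cW .
      qed (use Suc.prems(1,2) False split(1) in auto)
      moreover have "card ?G = ((card V - 1) choose k) - ((card V - 1 - r) choose k) - h"
        using cG' by linarith
      ultimately show ?thesis unfolding split(3) by (simp only: cW lex_value.simps(2))
    next
      case no_star: False
      have "2 \<le> Suc r" using False by simp
      moreover have "dp G \<le> dp H" if "H \<subseteq> nsets V k" "card H = card G" for H
        using min[OF that(1)] that(2) G(2) by simp
      moreover have "\<not> hit V k {i} \<subseteq> G" if "i \<in> V" for i using no_star that by blast
      ultimately obtain R where R: "R \<subseteq> V" "card R = Suc r" "G \<subseteq> hit V k R"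
        using extremal_covered[OF Suc.prems(1,2) _ Suc.prems(4) G(1) _ Suc.prems(6) cG] by blast
      have "card G + h = card (hit V k R)"
        using card_hit[OF Suc.prems(1) R(1), of k] cG unfolding R(2) by linarith
      moreover have "R \<noteq> {}" using R(2) by auto
      ultimately show ?thesis
        using dp_ge_if_covered[OF Suc.prems(1,2) R(1) _ R(3), of h] Suc.prems(6) unfolding R(2) by blast
    qed
    also have "\<dots> \<le> dp F" using min[OF Suc.prems(5)] by simp
    finally show ?thesis .
  qed
qed

text \<open>A set meeting \<open>{1..t}\<close> precedes every set that misses it: its minimum is at
  most \<open>t\<close>, and the other set has no point up to there. So the k-sets meeting
  \<open>{1..t}\<close> form an initial segment themselves.\<close>

lemma lex_initial_between:
  assumes "card (hit {1..n} k {1..a}) \<le> s" "s \<le> card (hit {1..n} k {1..b})"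
  shows "hit {1..n} k {1..a} \<subseteq> lex_initial n k s" "lex_initial n k s \<subseteq> hit {1..n} k {1..b}"
proof -
  have before: "lex_less A B" if A: "A \<in> hit {1..n} k {1..t}" and B: "B \<in> nsets {1..n} k" "B \<notin> hit {1..n} k {1..t}"
    for A B t
  proof -
    have fin: "finite A" "finite B" using A B by (auto simp: hit_def nsets_def)
    have A': "A \<inter> {1..t} \<noteq> {}" "A \<subseteq> {1..n}" using A by (auto simp: hit_def nsets_def)
    have B': "B \<inter> {1..t} = {}" "B \<subseteq> {1..n}" using B by (auto simp: hit_def nsets_def)
    define m where "m = Min A"
    have ne: "A \<noteq> {}" using A'(1) by blast
    have m: "m \<in> A" "\<And>x. x \<in> A \<Longrightarrow> m \<le> x" unfolding m_def using fin(1) ne by auto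
    have "m \<le> t" using A'(1) m(2) by fastforce
    then have "x \<notin> B" if "x \<le> m" for x using B' that by fastforce
    then have "m \<notin> B" "\<forall>i<m. i \<in> A \<longleftrightarrow> i \<in> B" using m(2) by (auto simp: not_le[symmetric])
    then show ?thesis using lex_less_iff[OF fin] m(1) by blast
  qed
  have finK: "finite (nsets {1..n} k)" by simp
  show "hit {1..n} k {1..a} \<subseteq> lex_initial n k s"
  proof
    fix A assume A: "A \<in> hit {1..n} k {1..a}"
    have AK: "A \<in> nsets {1..n} k" "finite A" using A by (auto simp: hit_def nsets_def)
    have "{B \<in> nsets {1..n} k. lex_less B A} \<subset> hit {1..n} k {1..a}"
    proof (rule psubsetI)
      show "{B \<in> nsets {1..n} k. lex_less B A} \<subseteq> hit {1..n} k {1..a}"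
      proof
        fix B assume B: "B \<in> {B \<in> nsets {1..n} k. lex_less B A}"
        then have "finite B" by (auto simp: nsets_def)
        then show "B \<in> hit {1..n} k {1..a}"
          using before[OF A, of B] B lex_less_trans[OF AK(2) \<open>finite B\<close> AK(2)] lex_less_irrefl[of A]
          by auto
      qed
      show "{B \<in> nsets {1..n} k. lex_less B A} \<noteq> hit {1..n} k {1..a}"
        using A lex_less_irrefl by blast
    qed
    then have "card {B \<in> nsets {1..n} k. lex_less B A} < card (hit {1..n} k {1..a})"
      by (intro psubset_card_mono) simp_all
    then show "A \<in> lex_initial n k s" using assms(1) AK(1) by (simp add: lex_initial_def)
  qed
  show "lex_initial n k s \<subseteq> hit {1..n} k {1..b}"
  proof (rule subsetI, rule ccontr)
    fix A assume A: "A \<in> lex_initial n k s" "A \<notin> hit {1..n} k {1..b}"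
    have AK: "A \<in> nsets {1..n} k" using A(1) by (simp add: lex_initial_def)
    have "hit {1..n} k {1..b} \<subseteq> {B \<in> nsets {1..n} k. lex_less B A}"
      using before[OF _ AK A(2)] by (auto simp: hit_def)
    then have "card (hit {1..n} k {1..b}) \<le> card {B \<in> nsets {1..n} k. lex_less B A}"
      using finK by (intro card_mono) auto
    then show False using A(1) assms(2) by (simp add: lex_initial_def)
  qed
qed

theorem theorem1p3:
  "\<exists>C::real. \<forall>(n::nat) (k::nat) (r::nat) (s::nat).
     n > 0 \<longrightarrow> k > 0 \<longrightarrow> r > 0 \<longrightarrow>
     real n \<ge> C * real k ^ 2 * real r ^ 3 \<longrightarrow>
     s \<le> (n choose k) - ((n - r) choose k) \<longrightarrow>
     (\<forall>\<F>. \<F> \<subseteq> nsets {1..n} k \<longrightarrow> card \<F> = s \<longrightarrow> dp \<F> \<ge> dp_lex n k s)"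
proof (intro exI[of _ "10 ^ 6"] allI impI)
  fix n k r s :: nat and F
  assume k: "k > 0" and r: "r > 0" and n: "real n \<ge> 10 ^ 6 * real k ^ 2 * real r ^ 3"
    and s: "s \<le> (n choose k) - ((n - r) choose k)"
    and F: "F \<subseteq> nsets {1..n} k" "card F = s"
  let ?t = "\<lambda>p. card (hit {1..n} k {1..p})"
  have rn: "r \<le> n"
  proof -
    have "real r \<le> real r ^ 3" using r by (intro self_le_power) auto
    also have "\<dots> \<le> (10 ^ 6 * real k ^ 2) * real r ^ 3"
    proof -
      have "1 \<le> real k ^ 2" using k by (simp add: one_le_power)
      then show ?thesis using mult_right_mono[of 1 "10 ^ 6 * real k ^ 2" "real r ^ 3"] by simp
    qed
    also have "\<dots> \<le> real n" using n .
    finally show ?thesis by simp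
  qed
  have tr: "?t p + ((n - p) choose k) = n choose k" if "p \<le> n" for p
    using card_hit[of "{1..n}" "{1..p}" k] that by simp
  have sr: "s \<le> ?t r" using tr[OF rn] s by linarith
  have "\<exists>p. p < r \<and> ?t p \<le> s \<and> s \<le> ?t (Suc p)"
  proof -
    \<comment> \<open>The number of stars fully contained in the segment when it ends inside the
      star of \<open>p + 1\<close>. It can be well below \<open>r\<close>, so the comparison is made
      with \<open>Suc p\<close> in place of \<open>r\<close>.\<close>
    define p where "p = (LEAST p. s \<le> ?t (Suc p))"
    have ex: "s \<le> ?t (Suc (r - 1))" using sr r by simp
    have p1: "s \<le> ?t (Suc p)" unfolding p_def by (rule LeastI[of _ "r - 1"]) (rule ex)
    have "p \<le> r - 1" unfolding p_def by (rule Least_le) (rule ex)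
    then have "p < r" using r by linarith
    moreover have "?t p \<le> s"
    proof (cases p)
      case 0
      then show ?thesis by (simp add: hit_def)
    next
      case (Suc p')
      then have "\<not> s \<le> ?t (Suc p')"
        using not_less_Least[of p' "\<lambda>p. s \<le> ?t (Suc p)"] unfolding p_def[symmetric] by simp
      then show ?thesis using Suc by simp
    qed
    ultimately show ?thesis using p1 by blast
  qed
  then obtain p where p: "p < r" "?t p \<le> s" "s \<le> ?t (Suc p)" by blast
  have pn: "Suc p \<le> n" using p(1) rn by simp
  define h where "h = ?t (Suc p) - s"
  have ins: "{1..Suc p} = insert (Suc p) {1..p}" by auto
  have step: "?t (Suc p) = ?t p + ((n - Suc p) choose (k - 1))"
    using card_hit_insert[of "{1..n}" "{1..p}" "Suc p" k] pn k ins by simp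
  have sn: "s \<le> n choose k" using s by linarith
  note L = lex_initial_between[OF p(2,3)]
  have "dp_lex n k s = lex_value k (Suc p) n h"
    using dp_lex_like[of "{1..n}" k "Suc p" "{1..p}" "lex_initial n k s" h] k pn L ins
      card_lex_initial[OF sn] p(3)
    by (simp add: dp_lex_def h_def del: lex_value.simps)
  also have "\<dots> \<le> dp F"
  proof -
    \<comment> \<open>The size condition for \<open>r\<close> implies the one for the smaller number
      \<open>Suc p\<close> of stars.\<close>
    have "10 ^ 6 * real k ^ 2 * real (Suc p) ^ 3 \<le> 10 ^ 6 * real k ^ 2 * real r ^ 3"
      using p(1) by (intro mult_left_mono power_mono) auto
    then have "10 ^ 6 * real k ^ 2 * real (Suc p) ^ 3 \<le> real (card {1..n})" using n by simp
    moreover have "h \<le> (n - Suc p) choose (k - 1)" using step p(2) by (simp add: h_def)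
    moreover have "card F + h + ((n - Suc p) choose k) = n choose k"
      using tr[OF pn] p(3) F(2) by (simp add: h_def)
    ultimately show ?thesis using lex_value_le_dp[of "{1..n}" k "Suc p" F h] k F(1) by simp
  qed
  finally show "dp F \<ge> dp_lex n k s" .
qed

end
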